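(* Let $\alpha\in (0,\pi/2)$ and let $\mathcal{H}$ be a complex Hilbert space of dimension at least $3$. Suppose $T\in \mathcal{B}(\mathcal{H})$ is nonzero and attains its norm at a unit vector $x\in \mathcal{H}$, i.e., $\|T(x)\| = \|T\|$. Then $W(T) \subseteq S(\alpha)$ and $\|T\|/w(T)=\tau (\alpha)$ if and only if the operator matrix of $T/\|T\|$ with respect to $V \oplus V^\perp$, where $V = \mathrm{span}\{x, T(x)\}$, has the form $T_1 \oplus T_2$, where $T_1$ is unitarily similar to $B/\|B\|$, $W(T_2) \subseteq S(\alpha)$ and $w(T_2) \le 1/\tau(\alpha)$. Here $B\in M_2$ is the matrix $$B = \begin{pmatrix} \cos \theta + c & \sin\alpha \\ -\sin\alpha & \cos\theta-c\end{pmatrix},$$ with $s=\sin^2\alpha$, $c = \dfrac{s}{\sqrt{1+2s}}$, and $\theta\in[0,\alpha]$ determined by $\sin^2\theta = \dfrac{s+s^2}{1+2s}$, $\cos^2 \theta = \dfrac{1+s-s^2}{1+2s}$.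
   Context: $\mathcal{B}(\mathcal{H})$ is the set of bounded linear operators on the complex Hilbert space $\mathcal{H}$ and $\|\cdot\|$ is the operator norm; $M_2$ is the set of $2\times2$ complex matrices. The numerical range of $T$ is $W(T)=\{\langle Ty,y\rangle : y\in\mathcal{H}, \|y\|=1\}$ and the numerical radius is $w(T)=\sup\{|\mu|:\mu\in W(T)\}$. $S(\alpha)=\{a+ib : a,b\in\mathbb{R},\ |b|\le a\tan\alpha\}$. The constant $\tau(\alpha)$ is $\tau(\alpha)=\sup\{\|T\|/w(T): T\in\mathcal{B}(\mathcal{H}),\ T\neq 0,\ W(T)\subseteq S(\alpha)\}$. *)

theory Defs
  imports "HOL-Analysis.Analysis"
begin

text \<open>Complex inner product spaces; the inner product is linear in its first argument.\<close>

class complex_inner = real_normed_vector +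
  fixes scaleC :: "complex \<Rightarrow> 'a \<Rightarrow> 'a"  (infixr \<open>*\<^sub>C\<close> 75)
    and cinner :: "'a \<Rightarrow> 'a \<Rightarrow> complex"
  assumes scaleC_add_right: "a *\<^sub>C (x + y) = a *\<^sub>C x + a *\<^sub>C y"
    and scaleC_add_left: "(a + b) *\<^sub>C x = a *\<^sub>C x + b *\<^sub>C x"
    and scaleC_scaleC: "a *\<^sub>C (b *\<^sub>C x) = (a * b) *\<^sub>C x"
    and scaleC_one: "1 *\<^sub>C x = x"
    and scaleR_scaleC: "r *\<^sub>R x = complex_of_real r *\<^sub>C x"
    and cinner_commute: "cinner x y = cnj (cinner y x)"
    and cinner_add_left: "cinner (x + y) z = cinner x z + cinner y z"
    and cinner_scaleC_left: "cinner (a *\<^sub>C x) y = a * cinner x y"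
    and cinner_ge_zero: "0 \<le> Re (cinner x x)"
    and cinner_eq_zero_iff: "cinner x x = 0 \<longleftrightarrow> x = 0"
    and norm_eq_sqrt_cinner: "norm x = sqrt (Re (cinner x x))"

class chilbert_space = complex_inner + complete_space

global_interpretation complex_vector:
  vector_space "scaleC :: complex \<Rightarrow> 'a \<Rightarrow> 'a::complex_inner"
  by unfold_locales (fact scaleC_add_right scaleC_add_left scaleC_scaleC scaleC_one)+

instantiation complex :: chilbert_space
begin

definition scaleC_complex :: "complex \<Rightarrow> complex \<Rightarrow> complex"
  where "scaleC_complex a x = a * x"

definition cinner_complex :: "complex \<Rightarrow> complex \<Rightarrow> complex"
  where "cinner_complex x y = x * cnj y"

instance
  by standard
    (auto simp: scaleC_complex_def cinner_complex_def algebra_simps scaleR_conv_of_real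
       cmod_def power2_eq_square)

end

instantiation vec :: (chilbert_space, finite) chilbert_space
begin

definition scaleC_vec :: "complex \<Rightarrow> 'a ^ 'b \<Rightarrow> 'a ^ 'b"
  where "scaleC_vec a x = (\<chi> i. a *\<^sub>C (x $ i))"

definition cinner_vec :: "'a ^ 'b \<Rightarrow> 'a ^ 'b \<Rightarrow> complex"
  where "cinner_vec x y = (\<Sum>i\<in>UNIV. cinner (x $ i) (y $ i))"

instance
proof
  fix a b :: complex and r :: real and x y z :: "'a ^ 'b"
  show "a *\<^sub>C (x + y) = a *\<^sub>C x + a *\<^sub>C y"
    by (simp add: scaleC_vec_def vec_eq_iff scaleC_add_right)
  show "(a + b) *\<^sub>C x = a *\<^sub>C x + b *\<^sub>C x"
    by (simp add: scaleC_vec_def vec_eq_iff scaleC_add_left)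
  show "a *\<^sub>C (b *\<^sub>C x) = (a * b) *\<^sub>C x"
    by (simp add: scaleC_vec_def vec_eq_iff scaleC_scaleC)
  show "1 *\<^sub>C x = x"
    by (simp add: scaleC_vec_def vec_eq_iff scaleC_one)
  show "r *\<^sub>R x = complex_of_real r *\<^sub>C x"
    by (simp add: scaleC_vec_def vec_eq_iff scaleR_scaleC)
  show "cinner x y = cnj (cinner y x)"
    unfolding cinner_vec_def cnj_sum by (intro sum.cong refl cinner_commute)
  show "cinner (x + y) z = cinner x z + cinner y z"
    by (simp add: cinner_vec_def cinner_add_left sum.distrib)
  show "cinner (a *\<^sub>C x) y = a * cinner x y"
    by (simp add: cinner_vec_def scaleC_vec_def cinner_scaleC_left sum_distrib_left)
  have Re_cinner: "Re (cinner x x) = (\<Sum>i\<in>UNIV. (norm (x $ i))\<^sup>2)"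
    by (simp add: cinner_vec_def norm_eq_sqrt_cinner cinner_ge_zero)
  show "0 \<le> Re (cinner x x)"
    unfolding Re_cinner by (simp add: sum_nonneg)
  show norm: "norm x = sqrt (Re (cinner x x))"
    unfolding Re_cinner by (simp add: norm_vec_def L2_set_def)
  have "cinner (0 :: 'a) 0 = 0"
    by (simp add: cinner_eq_zero_iff)
  then have "x = 0 \<Longrightarrow> cinner x x = 0"
    by (simp add: cinner_vec_def)
  then show "cinner x x = 0 \<longleftrightarrow> x = 0"
    using norm by auto
qed

end

text \<open>Operators on a subspace \<open>M\<close> are represented by functions on the whole space of which only
  the restriction to \<open>M\<close> matters. Thus \<open>bounded_clinear_on UNIV T\<close> says that \<open>T\<close> is a bounded linear operator.\<close>

definition bounded_clinear_on :: "'a set \<Rightarrow> ('a \<Rightarrow> 'a::complex_inner) \<Rightarrow> bool"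
  where "bounded_clinear_on M A \<longleftrightarrow>
    (\<forall>y\<in>M. A y \<in> M) \<and>
    (\<forall>y\<in>M. \<forall>z\<in>M. A (y + z) = A y + A z) \<and>
    (\<forall>a. \<forall>y\<in>M. A (a *\<^sub>C y) = a *\<^sub>C A y) \<and>
    (\<exists>K. \<forall>y\<in>M. norm (A y) \<le> K * norm y)"

lemma bounded_clinear_on_UNIV:
  "bounded_clinear_on UNIV A \<longleftrightarrow> bounded_linear A \<and> (\<forall>a y. A (a *\<^sub>C y) = a *\<^sub>C A y)"
proof -
  have "(\<exists>K. \<forall>y. norm (A y) \<le> K * norm y) \<longleftrightarrow> (\<exists>K. \<forall>y. norm (A y) \<le> norm y * K)"
    by (simp add: mult.commute)
  then show ?thesis
    unfolding bounded_clinear_on_def bounded_linear_def bounded_linear_axioms_def linear_iff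
    by (auto simp: scaleR_scaleC)
qed

definition numerical_range_on :: "'a set \<Rightarrow> ('a \<Rightarrow> 'a::complex_inner) \<Rightarrow> complex set"
  where "numerical_range_on M A = {cinner (A y) y |y. y \<in> M \<and> norm y = 1}"

definition numerical_radius_on :: "'a set \<Rightarrow> ('a \<Rightarrow> 'a::complex_inner) \<Rightarrow> real"
  where "numerical_radius_on M A = (SUP \<mu>\<in>numerical_range_on M A. cmod \<mu>)"

abbreviation numerical_range :: "('a \<Rightarrow> 'a::complex_inner) \<Rightarrow> complex set"
  where "numerical_range \<equiv> numerical_range_on UNIV"

abbreviation numerical_radius :: "('a \<Rightarrow> 'a::complex_inner) \<Rightarrow> real"
  where "numerical_radius \<equiv> numerical_radius_on UNIV"

definition sector :: "real \<Rightarrow> complex set"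
  where "sector \<alpha> = {Complex a b |a b. \<bar>b\<bar> \<le> a * tan \<alpha>}"

text \<open>The supremum is over the operators on the space given by the type argument. On complex-linear
  operators \<^const>\<open>onorm\<close> is the usual operator norm.\<close>

definition tau :: "'a::chilbert_space itself \<Rightarrow> real \<Rightarrow> real"
  where "tau _ \<alpha> = Sup {onorm T / numerical_radius T |T :: 'a \<Rightarrow> 'a.
    bounded_clinear_on UNIV T \<and> T \<noteq> (\<lambda>_. 0) \<and> numerical_range T \<subseteq> sector \<alpha>}"

definition orth_complement :: "'a::complex_inner set \<Rightarrow> 'a set"
  where "orth_complement V = {w. \<forall>v\<in>V. cinner w v = 0}"

text \<open>The operator matrix of \<open>A\<close> with respect to \<open>V\<close> and its orthogonal complement is block diagonal
  with blocks \<open>A\<^sub>1\<close> and \<open>A\<^sub>2\<close>. Used for closed \<open>V\<close>, so that the two subspaces span the whole space.\<close>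

definition is_direct_sum ::
    "('a \<Rightarrow> 'a::complex_inner) \<Rightarrow> 'a set \<Rightarrow> ('a \<Rightarrow> 'a) \<Rightarrow> ('a \<Rightarrow> 'a) \<Rightarrow> bool"
  where "is_direct_sum A V A\<^sub>1 A\<^sub>2 \<longleftrightarrow>
    bounded_clinear_on V A\<^sub>1 \<and> bounded_clinear_on (orth_complement V) A\<^sub>2 \<and>
    (\<forall>v\<in>V. \<forall>w\<in>orth_complement V. A (v + w) = A\<^sub>1 v + A\<^sub>2 w)"

definition unitary_onto :: "('b::complex_inner \<Rightarrow> 'a::complex_inner) \<Rightarrow> 'a set \<Rightarrow> bool"
  where "unitary_onto U V \<longleftrightarrow>
    (\<forall>z z'. U (z + z') = U z + U z') \<and> (\<forall>a z. U (a *\<^sub>C z) = a *\<^sub>C U z) \<and>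
    (\<forall>z z'. cinner (U z) (U z') = cinner z z') \<and> range U = V"

definition unitarily_similar_on ::
    "'a set \<Rightarrow> ('a \<Rightarrow> 'a::complex_inner) \<Rightarrow> complex ^ 'n ^ 'n \<Rightarrow> bool"
  where "unitarily_similar_on V A C \<longleftrightarrow>
    (\<exists>U :: complex ^ 'n \<Rightarrow> 'a. unitary_onto U V \<and> (\<forall>z. A (U z) = U (C *v z)))"

abbreviation matrix_norm :: "complex ^ 'n ^ 'n \<Rightarrow> real"
  where "matrix_norm C \<equiv> onorm (\<lambda>z. C *v z)"

end

theory Submission
  imports Defs
begin

text \<open>Write \<open>s = sin\<^sup>2 \<alpha>\<close> and let \<open>w\<close> be the numerical radius of \<open>T\<close>. For a unit vector \<open>x\<close> let
  \<open>T x = \<sigma> z\<close> with \<open>norm z = 1\<close> and \<open>\<sigma> \<ge> 0\<close>. Everything comes from testing the numerical range on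
  the circle of vectors \<open>x + l z\<close> with \<open>|l| = 1\<close>, on which the quadratic form of \<open>T\<close> takes the values
  \<open>P + \<sigma> cnj l + m l\<close>, where \<open>P = \<langle>T x, x\<rangle> + \<langle>T z, z\<rangle>\<close> and \<open>m = \<langle>T z, x\<rangle>\<close>.

  The two points \<open>l = \<i>, -\<i>\<close> and the disc of radius \<open>w\<close> bound \<open>|P|\<^sup>2 + |\<sigma> - m|\<^sup>2\<close> from above by
  \<open>4 w\<^sup>2 (1 + h\<^sup>2)\<close> with \<open>h = Im \<langle>x, z\<rangle>\<close> (\<open>disc_pencil\<close>). One side of the sector at \<open>l\<close>
  and the other side at \<open>cnj l\<close> together bound it from below by \<open>4 \<sigma>\<^sup>2 / (1 + s) + (Im P)\<^sup>2\<close> plus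
  squares (\<open>sector_pencil\<close>). If \<open>T\<close> attains its norm at \<open>x\<close>, then \<open>\<langle>T y, T x\<rangle> = \<sigma>\<^sup>2 \<langle>y, x\<rangle>\<close> for all
  \<open>y\<close>; so \<open>\<langle>T z, z\<rangle> = \<sigma> \<langle>z, x\<rangle>\<close> and \<open>Im P = - 2 \<sigma> h\<close>, which is large enough to absorb the \<open>h\<^sup>2\<close>
  of the upper bound, and \<open>\<sigma>\<^sup>2 \<le> (1 + s) w\<^sup>2\<close>. A perturbation of this argument proves
  \<open>\<parallel>T\<parallel>\<^sup>2 \<le> (1 + s) w\<^sup>2\<close> also for operators that do not attain their norm (\<open>sectorial_norm_le\<close>).

  The matrix \<open>B\<close> has norm \<open>sqrt (1 + 2 s)\<close> and numerical radius at most \<open>sqrt ((1 + 2 s) / (1 + s))\<close>,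
  and its numerical range lies in the sector. Hence \<open>B \<oplus> 0\<close> attains the bound and
  \<open>\<tau>(\<alpha>) = sqrt (1 + s)\<close> (\<open>tau_eq\<close>).

  Equality for a contraction \<open>A\<close> with \<open>norm (A x) = 1\<close> makes all the discarded squares vanish. This
  fixes \<open>\<langle>A x, x\<rangle> = \<langle>A z, z\<rangle>\<close> and \<open>\<langle>A z, x\<rangle>\<close> (\<open>extremal_contraction_entries\<close>), and in the
  orthonormal basis of \<open>V\<close> given by the directions of \<open>x + z\<close> and \<open>x - z\<close> they are the data of
  \<open>B / \<parallel>B\<parallel>\<close>. Moreover the numerical radius is attained at \<open>x + \<i> z\<close> and at \<open>x - \<i> z\<close>; the
  first-order conditions there are two linear equations which show that \<open>V\<close> reduces \<open>A\<close>
  (\<open>extremal_contraction_reduces\<close>). Conversely, the quadratic form of a direct sum is the sum of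
  the forms of the two blocks, and both the sector and the bound by \<open>1 / \<tau>(\<alpha>)\<close> are
  preserved under such sums.\<close>

section \<open>Complex inner product spaces\<close>

lemma cinner_add_right: "cinner x (y + z) = cinner x y + cinner x (z :: 'a :: complex_inner)"
  by (metis cinner_add_left cinner_commute complex_cnj_add)

lemma cinner_scaleC_right: "cinner x (a *\<^sub>C y) = cnj a * cinner x (y :: 'a :: complex_inner)"
  by (metis cinner_commute cinner_scaleC_left complex_cnj_mult)

lemma cinner_zero_left [simp]: "cinner 0 (y :: 'a :: complex_inner) = 0"
  by (metis add_cancel_right_right cinner_add_left)

lemma cinner_zero_right [simp]: "cinner y (0 :: 'a :: complex_inner) = 0"
  by (metis add_cancel_right_right cinner_add_right)

lemma cinner_uminus_left: "cinner (- x) (y :: 'a :: complex_inner) = - cinner x y"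
  by (metis add.right_inverse add_eq_0_iff cinner_add_left cinner_zero_left)

lemma cinner_diff_left: "cinner (x - y) (z :: 'a :: complex_inner) = cinner x z - cinner y z"
  by (metis add_uminus_conv_diff cinner_add_left cinner_uminus_left)

lemma cinner_diff_right: "cinner x (y - z) = cinner x y - cinner x (z :: 'a :: complex_inner)"
  by (metis cinner_commute cinner_diff_left complex_cnj_diff)

lemma cinner_self: "cinner x x = complex_of_real ((norm (x :: 'a :: complex_inner))\<^sup>2)"
proof (rule complex_eqI)
  show "Re (cinner x x) = Re (complex_of_real ((norm x)\<^sup>2))"
    by (simp add: norm_eq_sqrt_cinner cinner_ge_zero)
  have "cinner x x = cnj (cinner x x)"
    by (rule cinner_commute)
  then show "Im (cinner x x) = Im (complex_of_real ((norm x)\<^sup>2))"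
    by (metis Reals_cnj_iff complex_is_Real_iff Im_complex_of_real)
qed

lemma norm_scaleC: "norm (a *\<^sub>C x) = cmod a * norm (x :: 'a :: complex_inner)"
proof -
  have "complex_of_real ((norm (a *\<^sub>C x))\<^sup>2) = a * cnj a * cinner x x"
    unfolding cinner_self [of "a *\<^sub>C x", symmetric]
    by (simp add: cinner_scaleC_left cinner_scaleC_right)
  also have "\<dots> = complex_of_real ((cmod a * norm x)\<^sup>2)"
    by (simp only: complex_norm_square [symmetric] cinner_self power_mult_distrib of_real_mult)
  finally have "(norm (a *\<^sub>C x))\<^sup>2 = (cmod a * norm x)\<^sup>2"
    by (simp only: of_real_eq_iff)
  then show ?thesis
    by (simp add: power2_eq_iff_nonneg)
qed

lemmas cinner_simps = cinner_add_left cinner_add_right cinner_diff_left cinner_diff_right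
  cinner_scaleC_left cinner_scaleC_right

text \<open>Besides the inner product itself, this is applied to the defect form \<open>N\<^sup>2 \<langle>y, x\<rangle> - \<langle>T y, T x\<rangle>\<close> of an
  operator of norm at most \<open>N\<close> and to \<open>w (norm y)\<^sup>2 - Re (cnj \<mu> \<langle>T y, y\<rangle>)\<close> for an operator of numerical radius
  at most \<open>w\<close>. Since the form may be degenerate, a null vector is orthogonal to everything: this
  is how extremality of a vector becomes a linear equation.\<close>

lemma positive_form_Cauchy_Schwarz:
  fixes Q :: "'a::complex_inner \<Rightarrow> 'a \<Rightarrow> complex"
  assumes add: "\<And>x y z. Q (x + y) z = Q x z + Q y z"
    and scale: "\<And>a x y. Q (a *\<^sub>C x) y = a * Q x y"
    and herm: "\<And>x y. Q y x = cnj (Q x y)"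
    and pos: "\<And>x. 0 \<le> Re (Q x x)"
  shows "(cmod (Q x y))\<^sup>2 \<le> Re (Q x x) * Re (Q y y)"
proof -
  have add_r: "Q u (v + v') = Q u v + Q u v'" for u v v'
    by (metis add herm complex_cnj_add)
  have scale_r: "Q u (a *\<^sub>C v) = cnj a * Q u v" for u v a
    by (metis scale herm complex_cnj_mult)
  define k where "k = Q x y"
  have expand: "Re (Q (x + (complex_of_real r * k) *\<^sub>C y) (x + (complex_of_real r * k) *\<^sub>C y))
      = Re (Q x x) + 2 * r * (cmod k)\<^sup>2 + r\<^sup>2 * (cmod k)\<^sup>2 * Re (Q y y)" for r
  proof -
    have "Q y x = cnj k" by (simp add: herm [of y x] k_def)
    then show ?thesis
      unfolding add add_r scale scale_r cmod_power2
      by (simp add: k_def [symmetric] power2_eq_square algebra_simps)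
  qed
  have quad: "0 \<le> Re (Q x x) + 2 * r * (cmod k)\<^sup>2 + r\<^sup>2 * (cmod k)\<^sup>2 * Re (Q y y)" for r
    using pos expand by metis
  show ?thesis
  proof (cases "k = 0")
    case True
    then show ?thesis using pos by (simp add: k_def)
  next
    case False
    then have k: "(cmod k)\<^sup>2 > 0" by simp
    show ?thesis
    proof (cases "Re (Q y y) = 0")
      case True
      have "0 \<le> Re (Q x x) + 2 * (- (Re (Q x x) + 1) / (2 * (cmod k)\<^sup>2)) * (cmod k)\<^sup>2"
        using quad [of "- (Re (Q x x) + 1) / (2 * (cmod k)\<^sup>2)"] True by simp
      also have "\<dots> = - 1" using k by (simp add: field_simps)
      finally show ?thesis by simp
    next
      case False
      then have y: "Re (Q y y) > 0" using pos [of y] by simp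
      \<comment> \<open>the minimum of the quadratic polynomial in \<open>r\<close>\<close>
      have "0 \<le> Re (Q x x) + 2 * (- 1 / Re (Q y y)) * (cmod k)\<^sup>2
          + (- 1 / Re (Q y y))\<^sup>2 * (cmod k)\<^sup>2 * Re (Q y y)"
        by (rule quad)
      also have "\<dots> = Re (Q x x) - (cmod k)\<^sup>2 / Re (Q y y)"
        using y by (simp add: field_simps power2_eq_square)
      finally show ?thesis using y by (simp add: k_def field_simps)
    qed
  qed
qed

lemma clinear_add: "bounded_clinear_on UNIV T \<Longrightarrow> T (y + z) = T y + T z"
  and clinear_scaleC: "bounded_clinear_on UNIV T \<Longrightarrow> T (a *\<^sub>C y) = a *\<^sub>C T y"
  by (simp_all add: bounded_clinear_on_def)

lemma bounded_clinear_imp_bounded_linear: "bounded_clinear_on UNIV T \<Longrightarrow> bounded_linear T"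
  by (simp add: bounded_clinear_on_UNIV)

lemma norm_clinear_le: "bounded_clinear_on UNIV T \<Longrightarrow> norm (T y) \<le> onorm T * norm y"
  by (simp add: onorm bounded_clinear_imp_bounded_linear)

lemma cinner_norm_le: "cmod (cinner x y) \<le> norm x * norm (y :: 'a::complex_inner)"
proof -
  have "(cmod (cinner x y))\<^sup>2 \<le> Re (cinner x x) * Re (cinner y y)"
    by (rule positive_form_Cauchy_Schwarz)
      (simp_all add: cinner_add_left cinner_scaleC_left cinner_ge_zero, metis cinner_commute)
  then have "(cmod (cinner x y))\<^sup>2 \<le> (norm x * norm y)\<^sup>2"
    by (simp add: cinner_self power_mult_distrib)
  then show ?thesis by (rule power2_le_imp_le) simp
qed

section \<open>Numerical range and sector\<close>

text \<open>Multiplying by the positive number \<open>cos \<alpha>\<close> turns the sector into an intersection of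
  two half-planes with polynomial coefficients in \<open>sin \<alpha>\<close> and \<open>cos \<alpha>\<close>.\<close>

lemma sector_iff:
  assumes "0 < \<alpha>" "\<alpha> < pi / 2"
  shows "z \<in> sector \<alpha> \<longleftrightarrow> \<bar>Im z\<bar> * cos \<alpha> \<le> Re z * sin \<alpha>"
proof -
  have "cos \<alpha> > 0" using assms by (intro cos_gt_zero) auto
  then show ?thesis
    by (auto simp: sector_def tan_def field_simps complex_eq_iff
        intro!: exI [of _ "Re z"] exI [of _ "Im z"])
qed

lemma sector_Re_nonneg:
  assumes "0 < \<alpha>" "\<alpha> < pi / 2" "z \<in> sector \<alpha>"
  shows "0 \<le> Re z"
proof -
  have "sin \<alpha> > 0" "cos \<alpha> > 0" using assms by (auto intro!: sin_gt_zero2 cos_gt_zero)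
  moreover from this have "0 \<le> Re z * sin \<alpha>"
    using assms by (metis sector_iff abs_ge_zero mult_nonneg_nonneg order_less_imp_le order_trans)
  ultimately show ?thesis by (simp add: zero_le_mult_iff)
qed

lemma sector_add:
  assumes "0 < \<alpha>" "\<alpha> < pi / 2" "z \<in> sector \<alpha>" "z' \<in> sector \<alpha>"
  shows "z + z' \<in> sector \<alpha>"
proof -
  have "cos \<alpha> > 0" using assms by (intro cos_gt_zero) auto
  then have "\<bar>Im z + Im z'\<bar> * cos \<alpha> \<le> \<bar>Im z\<bar> * cos \<alpha> + \<bar>Im z'\<bar> * cos \<alpha>"
    by (simp flip: distrib_right)
  then show ?thesis
    using assms by (simp add: sector_iff algebra_simps)
qed

lemma sector_scale:
  assumes "0 < \<alpha>" "\<alpha> < pi / 2" "z \<in> sector \<alpha>" "0 \<le> r"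
  shows "complex_of_real r * z \<in> sector \<alpha>"
proof -
  have "r * (\<bar>Im z\<bar> * cos \<alpha>) \<le> r * (Re z * sin \<alpha>)"
    using assms by (intro mult_left_mono) (auto simp: sector_iff)
  then show ?thesis
    using assms by (simp add: sector_iff abs_mult algebra_simps)
qed

text \<open>Homogeneity: a condition on \<open>\<langle>T y, y\<rangle>\<close> that is stable under positive scaling may be tested on
  unit vectors. The set \<open>M\<close> will be the whole space or an orthogonal complement.\<close>

lemma numerical_range_on_cone:
  assumes T: "\<And>a y. y \<in> M \<Longrightarrow> T (a *\<^sub>C y) = a *\<^sub>C T y"
    and M: "\<And>a y. y \<in> M \<Longrightarrow> a *\<^sub>C y \<in> M" and y: "y \<in> M" "y \<noteq> 0"
  obtains \<mu> where "\<mu> \<in> numerical_range_on M T" "cinner (T y) y = complex_of_real ((norm y)\<^sup>2) * \<mu>"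
proof
  define a where "a = complex_of_real (1 / norm y)"
  have a: "norm (a *\<^sub>C y) = 1" using y by (simp add: norm_scaleC a_def norm_divide)
  show "cinner (T (a *\<^sub>C y)) (a *\<^sub>C y) \<in> numerical_range_on M T"
    unfolding numerical_range_on_def using M y a by blast
  show "cinner (T y) y = complex_of_real ((norm y)\<^sup>2) * cinner (T (a *\<^sub>C y)) (a *\<^sub>C y)"
    using y by (simp add: T cinner_simps a_def power2_eq_square field_simps)
qed

lemma numerical_range_on_subset_sectorD:
  assumes "0 < \<alpha>" "\<alpha> < pi / 2" "numerical_range_on M T \<subseteq> sector \<alpha>"
    and T: "\<And>a y. y \<in> M \<Longrightarrow> T (a *\<^sub>C y) = a *\<^sub>C T y"
    and M: "\<And>a y. y \<in> M \<Longrightarrow> a *\<^sub>C y \<in> M" and y: "y \<in> M"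
  shows "cinner (T y) y \<in> sector \<alpha>"
proof (cases "y = 0")
  case True
  then show ?thesis using assms(1,2) by (simp add: sector_iff)
next
  case False
  from numerical_range_on_cone [of M T y, OF T M y False] obtain \<mu>
    where "\<mu> \<in> numerical_range_on M T" "cinner (T y) y = complex_of_real ((norm y)\<^sup>2) * \<mu>"
    by metis
  then show ?thesis
    using assms(1-3) by (metis sector_scale subsetD zero_le_power2)
qed

lemma numerical_radius_onD:
  assumes le: "\<And>y. y \<in> M \<Longrightarrow> norm (T y) \<le> K * norm y"
    and T: "\<And>a y. y \<in> M \<Longrightarrow> T (a *\<^sub>C y) = a *\<^sub>C T y"
    and M: "\<And>a y. y \<in> M \<Longrightarrow> a *\<^sub>C y \<in> M" and y: "y \<in> M"
  shows "cmod (cinner (T y) y) \<le> numerical_radius_on M T * (norm y)\<^sup>2"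
proof (cases "y = 0")
  case True
  then show ?thesis by simp
next
  case False
  from numerical_range_on_cone [of M T y, OF T M y False] obtain \<mu>
    where \<mu>: "\<mu> \<in> numerical_range_on M T" "cinner (T y) y = complex_of_real ((norm y)\<^sup>2) * \<mu>"
    by metis
  have "cmod \<nu> \<le> K" if "\<nu> \<in> numerical_range_on M T" for \<nu>
  proof -
    from that obtain v where "v \<in> M" "norm v = 1" "\<nu> = cinner (T v) v"
      unfolding numerical_range_on_def by blast
    then show ?thesis using cinner_norm_le [of "T v" v] le [of v] by simp
  qed
  then have "bdd_above (cmod ` numerical_range_on M T)"
    by (auto simp: bdd_above_def)
  then have "cmod \<mu> \<le> numerical_radius_on M T"
    unfolding numerical_radius_on_def using \<mu>(1) by (intro cSUP_upper)
  then show ?thesis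
    unfolding \<mu>(2) norm_mult norm_of_real by (simp add: mult.commute mult_right_mono)
qed

lemma numerical_radius_on_le:
  assumes "\<And>y. y \<in> M \<Longrightarrow> cmod (cinner (T y) y) \<le> w * (norm y)\<^sup>2"
    and "y \<in> M" "norm y = 1"
  shows "numerical_radius_on M T \<le> w"
  unfolding numerical_radius_on_def
proof (rule cSUP_least)
  show "numerical_range_on M T \<noteq> {}"
    using assms(2,3) unfolding numerical_range_on_def by blast
  show "cmod \<mu> \<le> w" if "\<mu> \<in> numerical_range_on M T" for \<mu>
    using that assms(1) unfolding numerical_range_on_def by force
qed

lemma numerical_range_sector_UNIV:
  assumes "0 < \<alpha>" "\<alpha> < pi / 2" "bounded_clinear_on UNIV T"
  shows "numerical_range T \<subseteq> sector \<alpha> \<longleftrightarrow> (\<forall>y. cinner (T y) y \<in> sector \<alpha>)"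
proof
  assume "numerical_range T \<subseteq> sector \<alpha>"
  then show "\<forall>y. cinner (T y) y \<in> sector \<alpha>"
    using numerical_range_on_subset_sectorD [OF assms(1,2), of UNIV T] clinear_scaleC [OF assms(3)]
    by blast
qed (auto simp: numerical_range_on_def)

lemma cmod_cinner_le_numerical_radius:
  assumes "bounded_clinear_on UNIV T"
  shows "cmod (cinner (T y) y) \<le> numerical_radius T * (norm y)\<^sup>2"
  by (rule numerical_radius_onD [where K = "onorm T"])
    (simp_all add: norm_clinear_le [OF assms] clinear_scaleC [OF assms])

lemma numerical_radius_nonneg:
  fixes T :: "'a::complex_inner \<Rightarrow> 'a"
  assumes "bounded_clinear_on UNIV T" "norm (y :: 'a) = 1"
  shows "0 \<le> numerical_radius T"
  using order_trans [OF norm_ge_zero cmod_cinner_le_numerical_radius [OF assms(1), of y]] assms(2)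
  by simp

section \<open>Numerical range on a circle of vectors\<close>

text \<open>The half-plane \<open>0 \<le> Re (\<omega> f)\<close> with \<open>\<omega> = sin \<alpha> + \<i> cos \<alpha>\<close> is used at \<open>l\<close>, and its mirror
  image in the real axis at \<open>cnj l\<close>. In the sum of the two inequalities the imaginary parts of \<open>P\<close> and
  \<open>m\<close> cancel, and what remains is a real linear condition in \<open>(Re l, Im l)\<close>; its worst
  case on the unit circle is the claim.\<close>

lemma sector_circle_pencil:
  fixes P m :: complex and \<sigma> \<alpha> :: real
  assumes \<alpha>: "0 < \<alpha>" "\<alpha> < pi / 2"
    and sec: "\<And>l. cmod l = 1 \<Longrightarrow> P + cnj l * complex_of_real \<sigma> + l * m \<in> sector \<alpha>"
  shows "(cos \<alpha>)\<^sup>2 * (\<sigma> - Re m)\<^sup>2 + (sin \<alpha>)\<^sup>2 * (\<sigma> + Re m)\<^sup>2 \<le> (sin \<alpha>)\<^sup>2 * (Re P)\<^sup>2"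
proof -
  define A where "A = sin \<alpha> * (\<sigma> + Re m)"
  define B where "B = cos \<alpha> * (\<sigma> - Re m)"
  define R where "R = sqrt (A\<^sup>2 + B\<^sup>2)"
  have R2: "R\<^sup>2 = A\<^sup>2 + B\<^sup>2" by (simp add: R_def)
  have lin: "0 \<le> sin \<alpha> * Re P + u * A + v * B" if "u\<^sup>2 + v\<^sup>2 = 1" for u v
  proof -
    define l where "l = Complex u v"
    have l: "cmod l = 1" "cmod (cnj l) = 1" using that by (simp_all add: l_def cmod_def)
    have "\<bar>Im (P + cnj l * complex_of_real \<sigma> + l * m)\<bar> * cos \<alpha>
        \<le> Re (P + cnj l * complex_of_real \<sigma> + l * m) * sin \<alpha>"
      using sec [OF l(1)] sector_iff [OF \<alpha>] by blast
    moreover have "\<bar>Im (P + cnj (cnj l) * complex_of_real \<sigma> + cnj l * m)\<bar> * cos \<alpha>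
        \<le> Re (P + cnj (cnj l) * complex_of_real \<sigma> + cnj l * m) * sin \<alpha>"
      using sec [OF l(2)] sector_iff [OF \<alpha>] by blast
    moreover have "0 < cos \<alpha>" using \<alpha> by (intro cos_gt_zero) auto
    moreover have "- Im X * cos \<alpha> \<le> \<bar>Im X\<bar> * cos \<alpha>" "Im X * cos \<alpha> \<le> \<bar>Im X\<bar> * cos \<alpha>" for X
      by (rule mult_right_mono; use \<open>0 < cos \<alpha>\<close> in simp)+
    ultimately have "Im (P + cnj l * complex_of_real \<sigma> + l * m) * cos \<alpha>
        + - Im (P + cnj (cnj l) * complex_of_real \<sigma> + cnj l * m) * cos \<alpha>
        \<le> Re (P + cnj l * complex_of_real \<sigma> + l * m) * sin \<alpha>
          + Re (P + cnj (cnj l) * complex_of_real \<sigma> + cnj l * m) * sin \<alpha>"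
      by (meson add_mono order_trans)
    moreover have "2 * (sin \<alpha> * Re P + u * A + v * B)
        = Re (P + cnj l * complex_of_real \<sigma> + l * m) * sin \<alpha>
          + Re (P + cnj (cnj l) * complex_of_real \<sigma> + cnj l * m) * sin \<alpha>
          - (Im (P + cnj l * complex_of_real \<sigma> + l * m) * cos \<alpha>
            + - Im (P + cnj (cnj l) * complex_of_real \<sigma> + cnj l * m) * cos \<alpha>)"
      by (simp add: l_def A_def B_def algebra_simps)
    ultimately have "0 \<le> 2 * (sin \<alpha> * Re P + u * A + v * B)" by (simp only: diff_ge_0_iff_ge)
    then show ?thesis by (simp only: zero_le_mult_iff) simp
  qed
  have "R \<le> sin \<alpha> * Re P"
  proof (cases "R = 0")
    case True
    then have "A = 0" "B = 0" using R2 by (simp_all add: sum_power2_eq_zero_iff)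
    then show ?thesis using lin [of 1 0] True by simp
  next
    case False
    have "(- A / R)\<^sup>2 + (- B / R)\<^sup>2 = (A\<^sup>2 + B\<^sup>2) / R\<^sup>2"
      by (simp add: power_divide add_divide_distrib)
    also have "\<dots> = 1" unfolding R2 [symmetric] using False by simp
    finally have "(- A / R)\<^sup>2 + (- B / R)\<^sup>2 = 1" .
    \<comment> \<open>the minimising direction on the unit circle\<close>
    from lin [OF this] have "0 \<le> sin \<alpha> * Re P - (A\<^sup>2 + B\<^sup>2) / R"
      using False by (simp add: power2_eq_square add_divide_distrib)
    also have "(A\<^sup>2 + B\<^sup>2) / R = R" unfolding R2 [symmetric] by (simp add: power2_eq_square)
    finally show ?thesis by simp
  qed
  then have "R\<^sup>2 \<le> (sin \<alpha> * Re P)\<^sup>2" by (intro power_mono) (simp_all add: R_def)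
  then show ?thesis unfolding R2 A_def B_def power_mult_distrib by simp
qed

lemma clinear_pencil:
  fixes T :: "'a::complex_inner \<Rightarrow> 'a"
  assumes T: "bounded_clinear_on UNIV T"
    and x: "norm x = 1" "norm z = 1" "T x = complex_of_real \<sigma> *\<^sub>C z"
  shows "cinner (T (x + l *\<^sub>C z)) (x + l *\<^sub>C z) = cinner (T x) x + cnj l * complex_of_real \<sigma>
      + l * cinner (T z) x + (cmod l)\<^sup>2 * cinner (T z) z"
proof -
  have Tz: "cinner (T x) z = complex_of_real \<sigma>"
    by (simp add: x cinner_scaleC_left cinner_self)
  show ?thesis
    unfolding clinear_add [OF T] clinear_scaleC [OF T] complex_norm_square cinner_simps Tz
    by (simp add: algebra_simps)
qed

text \<open>Averaging over the two opposite points \<open>l = \<i>\<close> and \<open>l = - \<i>\<close> removes the cross terms, both in the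
  form and, up to \<open>h\<^sup>2\<close>, in the squared norms of the vectors.\<close>

lemma disc_pencil:
  fixes T :: "'a::complex_inner \<Rightarrow> 'a"
  assumes T: "bounded_clinear_on UNIV T"
    and rad: "\<And>y. cmod (cinner (T y) y) \<le> w * (norm y)\<^sup>2"
    and x: "norm x = 1" "norm z = 1" "T x = complex_of_real \<sigma> *\<^sub>C z"
  defines "P \<equiv> cinner (T x) x + cinner (T z) z" and "m \<equiv> cinner (T z) x" and "h \<equiv> Im (cinner x z)"
  shows "(cmod P)\<^sup>2 + (cmod (complex_of_real \<sigma> - m))\<^sup>2 \<le> 4 * w\<^sup>2 * (1 + h\<^sup>2)"
    and "(norm (x + \<i> *\<^sub>C z))\<^sup>2 = 2 + 2 * h" "(norm (x - \<i> *\<^sub>C z))\<^sup>2 = 2 - 2 * h"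
proof -
  note expand = clinear_pencil [OF T x]
  have zx: "cinner z x = cnj (cinner x z)" by (rule cinner_commute)
  have norm_eq: "(norm (x + l *\<^sub>C z))\<^sup>2 = 1 + (cmod l)\<^sup>2 + 2 * Re (cnj l * cinner x z)" for l
  proof -
    have "(norm (x + l *\<^sub>C z))\<^sup>2 = Re (cinner (x + l *\<^sub>C z) (x + l *\<^sub>C z))"
      by (simp add: cinner_self)
    also have "\<dots> = 1 + (cmod l)\<^sup>2 + 2 * Re (cnj l * cinner x z)"
      unfolding cinner_simps zx cmod_power2
      by (simp add: cinner_self x power2_eq_square algebra_simps)
    finally show ?thesis .
  qed
  have uminus: "x - \<i> *\<^sub>C z = x + (- \<i>) *\<^sub>C z"
    using scaleC_add_left [of "\<i>" "- \<i>" z] scaleC_add_left [of 0 0 z] by (simp add: algebra_simps)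
  show nplus: "(norm (x + \<i> *\<^sub>C z))\<^sup>2 = 2 + 2 * h"
    unfolding norm_eq by (simp add: h_def)
  show nminus: "(norm (x - \<i> *\<^sub>C z))\<^sup>2 = 2 - 2 * h"
    unfolding uminus norm_eq by (simp add: h_def)
  have plus: "cmod (P - \<i> * (complex_of_real \<sigma> - m)) \<le> 2 * w * (1 + h)"
    using rad [of "x + \<i> *\<^sub>C z"] unfolding expand nplus by (simp add: P_def m_def algebra_simps)
  have minus: "cmod (P + \<i> * (complex_of_real \<sigma> - m)) \<le> 2 * w * (1 - h)"
    using rad [of "x - \<i> *\<^sub>C z"] unfolding nminus unfolding uminus expand
    by (simp add: P_def m_def algebra_simps)
  have "(cmod (P - \<i> * (complex_of_real \<sigma> - m)))\<^sup>2 + (cmod (P + \<i> * (complex_of_real \<sigma> - m)))\<^sup>2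
      \<le> (2 * w * (1 + h))\<^sup>2 + (2 * w * (1 - h))\<^sup>2"
    by (intro add_mono power_mono plus minus) auto
  then show "(cmod P)\<^sup>2 + (cmod (complex_of_real \<sigma> - m))\<^sup>2 \<le> 4 * w\<^sup>2 * (1 + h\<^sup>2)"
    unfolding cmod_power2 by (simp add: power2_eq_square algebra_simps)
qed

text \<open>After \<open>n = \<sigma> - Re m\<close> the bound on \<open>Re P\<close> from the sector is quadratic in \<open>n\<close>; completing
  the square gives the value \<open>4 \<sigma>\<^sup>2 / (1 + s)\<close>. The square is kept, because it determines \<open>Re m\<close> in the
  case of equality.\<close>

lemma sector_pencil:
  fixes T :: "'a::complex_inner \<Rightarrow> 'a"
  assumes \<alpha>: "0 < \<alpha>" "\<alpha> < pi / 2"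
    and T: "bounded_clinear_on UNIV T"
    and sec: "\<And>y. cinner (T y) y \<in> sector \<alpha>"
    and x: "norm x = 1" "norm z = 1" "T x = complex_of_real \<sigma> *\<^sub>C z"
    and s: "s = (sin \<alpha>)\<^sup>2"
  defines "P \<equiv> cinner (T x) x + cinner (T z) z" and "m \<equiv> cinner (T z) x"
  shows "(1 + s) / s * (\<sigma> - Re m - 2 * s * \<sigma> / (1 + s))\<^sup>2 + 4 * \<sigma>\<^sup>2 / (1 + s) + (Im P)\<^sup>2 + (Im m)\<^sup>2
    \<le> (cmod P)\<^sup>2 + (cmod (complex_of_real \<sigma> - m))\<^sup>2"
proof -
  have "P + cnj l * complex_of_real \<sigma> + l * m \<in> sector \<alpha>" if "cmod l = 1" for l
  proof -
    have "cinner (T (x + l *\<^sub>C z)) (x + l *\<^sub>C z) = P + cnj l * complex_of_real \<sigma> + l * m"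
      unfolding clinear_pencil [OF T x] using that by (simp add: P_def m_def)
    then show ?thesis using sec by metis
  qed
  from sector_circle_pencil [OF \<alpha> this]
  have "(1 - s) * (\<sigma> - Re m)\<^sup>2 + s * (\<sigma> + Re m)\<^sup>2 \<le> s * (Re P)\<^sup>2"
    by (simp add: s cos_squared_eq)
  moreover have "s > 0" using \<alpha> by (simp add: s sin_gt_zero2 less_imp_neq [symmetric] zero_less_power)
  ultimately have "((1 - s) * (\<sigma> - Re m)\<^sup>2 + s * (\<sigma> + Re m)\<^sup>2) / s \<le> (Re P)\<^sup>2"
    by (simp add: field_simps)
  moreover have "((1 - s) * (\<sigma> - Re m)\<^sup>2 + s * (\<sigma> + Re m)\<^sup>2) / s + (\<sigma> - Re m)\<^sup>2
      = (1 + s) / s * (\<sigma> - Re m - 2 * s * \<sigma> / (1 + s))\<^sup>2 + 4 * \<sigma>\<^sup>2 / (1 + s)"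
  proof -
    define n where "n = \<sigma> - Re m"
    have m: "Re m = \<sigma> - n" by (simp add: n_def)
    have "s + 1 \<noteq> 0" using \<open>s > 0\<close> by simp
    then show ?thesis unfolding m using \<open>s > 0\<close> by (simp add: divide_simps) algebra
  qed
  ultimately show ?thesis by (simp add: cmod_power2)
qed

section \<open>The sharp norm bound\<close>

text \<open>If \<open>N\<close> is nearly attained at \<open>x\<close>, then \<open>\<langle>T y, T x\<rangle>\<close> is nearly \<open>N\<^sup>2 \<langle>y, x\<rangle>\<close>. This says without
  adjoints that a norm attaining vector is an eigenvector of \<open>T\<^sup>* T\<close>.\<close>

lemma norm_defect_form:
  fixes T :: "'a::complex_inner \<Rightarrow> 'a"
  assumes T: "bounded_clinear_on UNIV T" and le: "\<And>y. norm (T y) \<le> N * norm y"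
  shows "(cmod (N\<^sup>2 * cinner y x - cinner (T y) (T x)))\<^sup>2
    \<le> (N\<^sup>2 * (norm y)\<^sup>2 - (norm (T y))\<^sup>2) * (N\<^sup>2 * (norm x)\<^sup>2 - (norm (T x))\<^sup>2)"
proof -
  let ?Q = "\<lambda>y x. N\<^sup>2 * cinner y x - cinner (T y) (T x)"
  have Q: "Re (?Q y y) = N\<^sup>2 * (norm y)\<^sup>2 - (norm (T y))\<^sup>2" for y
    by (simp add: cinner_self flip: of_real_power of_real_mult)
  have "(cmod (?Q y x))\<^sup>2 \<le> Re (?Q y y) * Re (?Q x x)"
  proof (rule positive_form_Cauchy_Schwarz)
    show "?Q y x = cnj (?Q x y)" for x y
      by (simp flip: cinner_commute)
    show "0 \<le> Re (?Q y y)" for y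
      unfolding Q using power_mono [OF le [of y], of 2] by (simp add: power_mult_distrib)
  qed (simp_all add: clinear_add [OF T] clinear_scaleC [OF T] cinner_simps algebra_simps)
  then show ?thesis unfolding Q by simp
qed

text \<open>The two estimates on the circle combine only when \<open>Im P\<close> is close to \<open>- 2 \<sigma> h\<close>. The error is
  controlled by how far \<open>x\<close> is from attaining the norm, and it vanishes when \<open>norm (T x)\<close> tends to \<open>N\<close>.\<close>

lemma sectorial_norm_image_estimate:
  fixes T :: "'a::complex_inner \<Rightarrow> 'a"
  assumes \<alpha>: "0 < \<alpha>" "\<alpha> < pi / 2"
    and T: "bounded_clinear_on UNIV T"
    and sec: "\<And>y. cinner (T y) y \<in> sector \<alpha>"
    and rad: "\<And>y. cmod (cinner (T y) y) \<le> w * (norm y)\<^sup>2"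
    and s: "s = (sin \<alpha>)\<^sup>2"
    and le: "\<And>y. norm (T y) \<le> N * norm y"
    and x: "norm x = 1"
  shows "(norm (T x))\<^sup>2 / (1 + s) - N * sqrt (N\<^sup>2 - (norm (T x))\<^sup>2) - (N\<^sup>2 - (norm (T x))\<^sup>2) \<le> w\<^sup>2"
proof -
  define \<sigma> where "\<sigma> = norm (T x)"
  have \<sigma>: "0 \<le> \<sigma>" "\<sigma> \<le> N" using le [of x] x by (simp_all add: \<sigma>_def)
  have s0: "0 \<le> s" by (simp add: s)
  \<comment> \<open>the deviation of \<open>\<sigma> * Im P\<close> from its value \<open>- 2 * \<sigma>\<^sup>2 * h\<close> at a norm attaining vector is at most \<open>d\<close>\<close>
  define d where "d = N * sqrt (N\<^sup>2 - \<sigma>\<^sup>2) + (N\<^sup>2 - \<sigma>\<^sup>2)"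
  have N\<sigma>: "0 \<le> N\<^sup>2 - \<sigma>\<^sup>2" using \<sigma> by (simp add: power_mono)
  have d0: "0 \<le> d" using \<sigma> N\<sigma> by (simp add: d_def)
  have "\<sigma>\<^sup>2 / (1 + s) - d \<le> w\<^sup>2"
  proof (cases "\<sigma> = 0")
    case True
    then show ?thesis using d0 by (simp add: order_trans [of _ 0])
  next
    case False
    then have \<sigma>0: "\<sigma> > 0" using \<sigma> by simp
    define z where "z = complex_of_real (1 / \<sigma>) *\<^sub>C T x"
    have z: "norm z = 1" "T x = complex_of_real \<sigma> *\<^sub>C z"
      using \<sigma>0 by (simp_all add: z_def norm_scaleC norm_divide \<sigma>_def scaleC_scaleC scaleC_one)
    define P where "P = cinner (T x) x + cinner (T z) z"
    define h where "h = Im (cinner x z)"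
    have "cmod (cinner x z) \<le> 1" using cinner_norm_le [of x z] x z by simp
    then have h: "\<bar>h\<bar> \<le> 1" unfolding h_def using abs_Im_le_cmod order_trans by blast
    define D where "D = N\<^sup>2 * cinner z x - cinner (T z) (T x)"
    have "(cmod D)\<^sup>2 \<le> (N\<^sup>2 * (norm z)\<^sup>2 - (norm (T z))\<^sup>2) * (N\<^sup>2 * (norm x)\<^sup>2 - (norm (T x))\<^sup>2)"
      unfolding D_def using norm_defect_form [OF T le, of z x] by simp
    also have "\<dots> \<le> N\<^sup>2 * (N\<^sup>2 - \<sigma>\<^sup>2)"
      unfolding z(1) x \<sigma>_def [symmetric] using N\<sigma> by (simp add: mult_right_mono)
    also have "\<dots> = (N * sqrt (N\<^sup>2 - \<sigma>\<^sup>2))\<^sup>2" using N\<sigma> by (simp add: power_mult_distrib)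
    finally have "cmod D \<le> N * sqrt (N\<^sup>2 - \<sigma>\<^sup>2)"
      by (rule power2_le_imp_le) (use \<sigma> N\<sigma> in simp)
    then have ImD: "\<bar>Im D\<bar> \<le> N * sqrt (N\<^sup>2 - \<sigma>\<^sup>2)" using abs_Im_le_cmod order_trans by blast
    have "Im (cinner z x) = - h" unfolding h_def by (subst cinner_commute) simp
    then have "\<sigma> * (Im P + 2 * \<sigma> * h) = - ((N\<^sup>2 - \<sigma>\<^sup>2) * h) - Im D"
      unfolding P_def D_def z(2)
      by (simp add: cinner_simps algebra_simps power2_eq_square)
    then have "\<bar>\<sigma> * (Im P + 2 * \<sigma> * h)\<bar> \<le> \<bar>(N\<^sup>2 - \<sigma>\<^sup>2) * h\<bar> + \<bar>Im D\<bar>" by linarith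
    also have "\<bar>(N\<^sup>2 - \<sigma>\<^sup>2) * h\<bar> \<le> N\<^sup>2 - \<sigma>\<^sup>2"
      using h N\<sigma> by (simp add: abs_mult mult_left_le)
    finally have e: "\<bar>\<sigma> * (Im P + 2 * \<sigma> * h)\<bar> \<le> d" using ImD by (simp add: d_def)
    have "\<bar>h * (\<sigma> * (Im P + 2 * \<sigma> * h))\<bar> \<le> 1 * d"
      unfolding abs_mult [of h] using h e by (intro mult_mono) auto
    then have "4 * (h * (\<sigma> * (Im P + 2 * \<sigma> * h))) \<le> 4 * d" by linarith
    moreover have "(Im P)\<^sup>2 = (Im P + 2 * \<sigma> * h)\<^sup>2 - 4 * (h * (\<sigma> * (Im P + 2 * \<sigma> * h))) + 4 * \<sigma>\<^sup>2 * h\<^sup>2"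
      by algebra
    moreover have "0 \<le> (Im P + 2 * \<sigma> * h)\<^sup>2" by simp
    ultimately have ImP: "4 * \<sigma>\<^sup>2 * h\<^sup>2 - 4 * d \<le> (Im P)\<^sup>2" by linarith
    have "(1 + s) / s * (\<sigma> - Re (cinner (T z) x) - 2 * s * \<sigma> / (1 + s))\<^sup>2 + 4 * \<sigma>\<^sup>2 / (1 + s)
        + (Im P)\<^sup>2 + (Im (cinner (T z) x))\<^sup>2 \<le> 4 * w\<^sup>2 * (1 + h\<^sup>2)"
      unfolding P_def h_def
      by (rule order_trans [OF sector_pencil [OF \<alpha> T sec x z s] disc_pencil(1) [OF T rad x z]])
    moreover have "0 \<le> (1 + s) / s * (\<sigma> - Re (cinner (T z) x) - 2 * s * \<sigma> / (1 + s))\<^sup>2"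
      using s0 by simp
    ultimately have sum: "4 * (\<sigma>\<^sup>2 / (1 + s)) + 4 * \<sigma>\<^sup>2 * h\<^sup>2 - 4 * d \<le> 4 * (w\<^sup>2 * (1 + h\<^sup>2))"
      using ImP zero_le_power2 [of "Im (cinner (T z) x)"]
      unfolding times_divide_eq_right [symmetric] mult.assoc by linarith
    have "\<sigma>\<^sup>2 / (1 + s) * h\<^sup>2 \<le> \<sigma>\<^sup>2 * h\<^sup>2"
      using s0 by (intro mult_right_mono) (simp_all add: divide_le_eq mult_le_cancel_left1)
    moreover have "0 \<le> d * h\<^sup>2" using d0 by simp
    moreover have "(\<sigma>\<^sup>2 / (1 + s) - d) * (1 + h\<^sup>2)
        = \<sigma>\<^sup>2 / (1 + s) + \<sigma>\<^sup>2 / (1 + s) * h\<^sup>2 - d - d * h\<^sup>2"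
      by (simp add: add_divide_distrib algebra_simps)
    ultimately have "(\<sigma>\<^sup>2 / (1 + s) - d) * (1 + h\<^sup>2) \<le> w\<^sup>2 * (1 + h\<^sup>2)"
      using sum by linarith
    then show ?thesis by (rule mult_right_le_imp_le) (simp add: add_pos_nonneg)
  qed
  then show ?thesis by (simp add: d_def \<sigma>_def algebra_simps)
qed

lemma onorm_approx:
  fixes T :: "'a::complex_inner \<Rightarrow> 'a"
  assumes T: "bounded_clinear_on UNIV T" and r: "0 \<le> r" "r < onorm T"
  obtains x where "norm x = 1" "r < norm (T x)"
proof -
  obtain y where y: "r * norm y < norm (T y)"
    using onorm_bound [of r T] r by (metis linorder_not_le)
  then have y0: "norm y > 0"
    using norm_clinear_le [OF T, of y] by (cases "y = 0") auto
  define a where "a = complex_of_real (1 / norm y)"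
  have "norm (a *\<^sub>C y) = 1" "norm (T (a *\<^sub>C y)) = norm (T y) / norm y"
    using y0 by (simp_all add: norm_scaleC a_def norm_divide clinear_scaleC [OF T])
  moreover have "r < norm (T y) / norm y" using y y0 by (simp add: field_simps)
  ultimately show ?thesis using that by metis
qed

text \<open>The limit of the preceding estimate along a sequence of unit vectors that norms \<open>T\<close>.\<close>

theorem sectorial_norm_le:
  fixes T :: "'a::complex_inner \<Rightarrow> 'a"
  assumes \<alpha>: "0 < \<alpha>" "\<alpha> < pi / 2"
    and T: "bounded_clinear_on UNIV T"
    and sec: "\<And>y. cinner (T y) y \<in> sector \<alpha>"
    and rad: "\<And>y. cmod (cinner (T y) y) \<le> w * (norm y)\<^sup>2"
    and s: "s = (sin \<alpha>)\<^sup>2"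
  shows "(onorm T)\<^sup>2 \<le> (1 + s) * w\<^sup>2"
proof (cases "onorm T = 0")
  case True
  then show ?thesis by (simp add: s)
next
  case False
  define N where "N = onorm T"
  have N: "N > 0"
    using False onorm_pos_le [OF bounded_clinear_imp_bounded_linear [OF T]] by (simp add: N_def)
  have "\<exists>x. norm x = 1 \<and> N - N / real (Suc n) < norm (T x)" for n
  proof -
    have "0 \<le> N - N / real (Suc n)" "N - N / real (Suc n) < N"
      using N by (simp_all add: field_simps)
    then show ?thesis using onorm_approx [OF T] unfolding N_def by metis
  qed
  then obtain u where u: "\<And>n. norm (u n) = 1" "\<And>n. N - N / real (Suc n) < norm (T (u n))"
    by metis
  have uN: "norm (T (u n)) \<le> N" for n
    using norm_clinear_le [OF T, of "u n"] u by (simp add: N_def)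
  have lim: "(\<lambda>n. norm (T (u n))) \<longlonglongrightarrow> N"
  proof (rule tendsto_sandwich [of "\<lambda>n. N - N / real (Suc n)" _ _ "\<lambda>n. N"])
    show "(\<lambda>n. N - N / real (Suc n)) \<longlonglongrightarrow> N"
      using tendsto_diff [OF tendsto_const tendsto_mult [OF tendsto_const LIMSEQ_inverse_real_of_nat],
          of N N]
      by (simp add: divide_inverse)
  qed (use less_imp_le [OF u(2)] uN in \<open>simp_all del: of_nat_Suc\<close>)
  define \<phi> where "\<phi> = (\<lambda>r. r\<^sup>2 / (1 + s) - N * sqrt (N\<^sup>2 - r\<^sup>2) - (N\<^sup>2 - r\<^sup>2))"
  have s0: "1 + s \<noteq> 0" by (simp add: s add_nonneg_eq_0_iff)
  have "(\<lambda>n. \<phi> (norm (T (u n)))) \<longlonglongrightarrow> \<phi> N"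
    unfolding \<phi>_def using s0 by (intro tendsto_intros lim)
  moreover have "\<phi> (norm (T (u n))) \<le> w\<^sup>2" for n
    unfolding \<phi>_def
    by (rule sectorial_norm_image_estimate [OF \<alpha> T sec rad s _ u(1)])
      (simp add: N_def norm_clinear_le [OF T])
  ultimately have "\<phi> N \<le> w\<^sup>2" using LIMSEQ_le_const2 by blast
  moreover have "0 < 1 + s" by (simp add: s add_pos_nonneg)
  ultimately show ?thesis by (simp add: \<phi>_def N_def field_simps)
qed

lemma sectorial_ratio_le:
  fixes T :: "'a::complex_inner \<Rightarrow> 'a"
  assumes \<alpha>: "0 < \<alpha>" "\<alpha> < pi / 2" and s: "s = (sin \<alpha>)\<^sup>2"
    and T: "bounded_clinear_on UNIV T" "numerical_range T \<subseteq> sector \<alpha>" and y: "norm (y :: 'a) = 1"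
  shows "onorm T \<le> sqrt (1 + s) * numerical_radius T"
proof -
  have "(onorm T)\<^sup>2 \<le> (1 + s) * (numerical_radius T)\<^sup>2"
    using sectorial_norm_le [OF \<alpha> T(1) _ cmod_cinner_le_numerical_radius [OF T(1)] s]
      T(2) numerical_range_sector_UNIV [OF \<alpha> T(1)] by blast
  also have "\<dots> = (sqrt (1 + s) * numerical_radius T)\<^sup>2" by (simp add: power_mult_distrib s)
  finally show ?thesis
    by (rule power2_le_imp_le) (simp add: s numerical_radius_nonneg [OF T(1) y])
qed

lemma sectorial_ratio_eq:
  fixes T :: "'a::complex_inner \<Rightarrow> 'a"
  assumes \<alpha>: "0 < \<alpha>" "\<alpha> < pi / 2" and s: "s = (sin \<alpha>)\<^sup>2"
    and T: "bounded_clinear_on UNIV T" "numerical_range T \<subseteq> sector \<alpha>" and y: "norm (y :: 'a) = 1"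
    and pos: "0 < onorm T" and le: "sqrt (1 + s) * numerical_radius T \<le> onorm T"
  shows "onorm T / numerical_radius T = sqrt (1 + s)"
proof -
  have "onorm T = sqrt (1 + s) * numerical_radius T"
    using sectorial_ratio_le [OF \<alpha> s T y] le by simp
  with pos show ?thesis by auto
qed

section \<open>Rigidity of extremal contractions\<close>

text \<open>At a vector where the numerical radius is attained, with phase \<open>\<mu>\<close>, the positive form
  \<open>2 w \<langle>u, y\<rangle> - \<langle>(cnj \<mu> T + \<mu> T\<^sup>*) u, y\<rangle>\<close> has a null vector; hence \<open>v\<close> is an eigenvector of
  \<open>cnj \<mu> T + \<mu> T\<^sup>*\<close>.\<close>

lemma numerical_radius_attained:
  fixes T :: "'a::complex_inner \<Rightarrow> 'a"
  assumes T: "bounded_clinear_on UNIV T"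
    and rad: "\<And>y. cmod (cinner (T y) y) \<le> w * (norm y)\<^sup>2"
    and \<mu>: "cmod \<mu> = 1" and v: "cinner (T v) v = complex_of_real (w * (norm v)\<^sup>2) * \<mu>"
  shows "cnj \<mu> * cinner (T v) y + \<mu> * cnj (cinner (T y) v) = 2 * complex_of_real w * cinner v y"
proof -
  let ?Q = "\<lambda>u y. 2 * complex_of_real w * cinner u y - cnj \<mu> * cinner (T u) y - \<mu> * cnj (cinner (T y) u)"
  have Q: "Re (?Q u u) = 2 * (w * (norm u)\<^sup>2 - Re (cnj \<mu> * cinner (T u) u))" for u
    by (simp add: cinner_self algebra_simps)
  have "(cmod (?Q v y))\<^sup>2 \<le> Re (?Q v v) * Re (?Q y y)"
  proof (rule positive_form_Cauchy_Schwarz)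
    show "?Q y u = cnj (?Q u y)" for u y
      by (simp flip: cinner_commute add: algebra_simps)
    show "0 \<le> Re (?Q u u)" for u
    proof -
      have "Re (cnj \<mu> * cinner (T u) u) \<le> cmod (cnj \<mu> * cinner (T u) u)"
        by (rule complex_Re_le_cmod)
      also have "\<dots> \<le> w * (norm u)\<^sup>2" using rad [of u] \<mu> by (simp add: norm_mult)
      finally show ?thesis unfolding Q by simp
    qed
  qed (simp_all add: clinear_add [OF T] clinear_scaleC [OF T] cinner_simps algebra_simps)
  also have "Re (?Q v v) = 0"
  proof -
    have "cnj \<mu> * \<mu> = 1" using \<mu> complex_norm_square [of \<mu>] by (simp add: mult.commute)
    then have "cnj \<mu> * cinner (T v) v = complex_of_real (w * (norm v)\<^sup>2)"
      unfolding v by (simp add: algebra_simps)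
    then show ?thesis unfolding Q by simp
  qed
  finally have "?Q v y = 0" by simp
  then show ?thesis by (simp add: algebra_simps)
qed

text \<open>With \<open>w\<^sup>2 = 1 / (1 + s)\<close> the lower and the upper bound for \<open>|P|\<^sup>2 + |1 - m|\<^sup>2\<close> coincide up to
  nonnegative terms, including \<open>4 h\<^sup>2 s / (1 + s)\<close>, so that all these terms are zero. The modulus of
  \<open>\<langle>A x, x\<rangle> = P / 2\<close> follows from the common value of the two bounds, and the sector fixes its sign.\<close>

lemma extremal_contraction_entries:
  fixes A :: "'a::complex_inner \<Rightarrow> 'a"
  assumes \<alpha>: "0 < \<alpha>" "\<alpha> < pi / 2"
    and A: "bounded_clinear_on UNIV A"
    and sec: "\<And>y. cinner (A y) y \<in> sector \<alpha>"
    and rad: "\<And>y. cmod (cinner (A y) y) \<le> w * (norm y)\<^sup>2"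
    and s: "s = (sin \<alpha>)\<^sup>2" and w: "w\<^sup>2 = 1 / (1 + s)"
    and le: "\<And>y. norm (A y) \<le> norm y"
    and x: "norm x = 1" "norm (A x) = 1"
  shows "cinner (A y) (A x) = cinner y x"
    and "cinner (A x) x = complex_of_real (sqrt (1 + s - s\<^sup>2) / (1 + s))"
    and "cinner (A (A x)) x = complex_of_real ((1 - s) / (1 + s))"
proof -
  define z where "z = A x"
  have z: "norm z = 1" "A x = complex_of_real 1 *\<^sub>C z"
    using x by (simp_all add: z_def scaleC_one)
  have iso: "cinner (A y) (A x) = cinner y x" for y
    using norm_defect_form [OF A, of 1 y x] le x by simp
  then show "cinner (A y) (A x) = cinner y x" .
  have s0: "0 < s" using \<alpha> by (simp add: s sin_gt_zero2 less_imp_neq [symmetric] zero_less_power)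
  define g where "g = cinner z x"
  define m where "m = cinner (A z) x"
  define h where "h = Im (cinner x z)"
  have P: "cinner (A x) x + cinner (A z) z = 2 * g"
    using iso [of z] by (simp add: g_def z_def)
  have Img: "Im g = - h" unfolding h_def g_def by (subst cinner_commute) simp
  have lower: "(1 + s) / s * (1 - Re m - 2 * s * 1 / (1 + s))\<^sup>2 + 4 * 1\<^sup>2 / (1 + s) + (Im (2 * g))\<^sup>2
      + (Im m)\<^sup>2 \<le> (cmod (2 * g))\<^sup>2 + (cmod (complex_of_real 1 - m))\<^sup>2"
    unfolding P [symmetric] m_def by (rule sector_pencil [OF \<alpha> A sec x(1) z s])
  have upper: "(cmod (2 * g))\<^sup>2 + (cmod (complex_of_real 1 - m))\<^sup>2 \<le> 4 * w\<^sup>2 * (1 + h\<^sup>2)"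
    unfolding P [symmetric] m_def h_def by (rule disc_pencil(1) [OF A rad x(1) z])
  have "1 + s \<noteq> 0" using s0 by simp
  then have "4 * h\<^sup>2 * (s / (1 + s)) = 4 * h\<^sup>2 - 4 * (1 / (1 + s)) * h\<^sup>2"
    by (simp add: divide_simps) algebra
  moreover have "4 * (1 / (1 + s)) * (1 + h\<^sup>2) = 4 / (1 + s) + 4 * (1 / (1 + s)) * h\<^sup>2"
    by (simp add: distrib_left add_divide_distrib)
  moreover have "(Im (2 * g))\<^sup>2 = 4 * h\<^sup>2" by (simp add: Img power_mult_distrib)
  ultimately have "(1 + s) / s * (1 - Re m - 2 * s / (1 + s))\<^sup>2 + (Im m)\<^sup>2 + 4 * h\<^sup>2 * (s / (1 + s)) \<le> 0"
    using order_trans [OF lower upper] unfolding w by simp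
  moreover have "0 \<le> (1 + s) / s * (1 - Re m - 2 * s / (1 + s))\<^sup>2" "0 \<le> 4 * h\<^sup>2 * (s / (1 + s))"
    using s0 by simp_all
  ultimately have "(1 + s) / s * (1 - Re m - 2 * s / (1 + s))\<^sup>2 = 0" "(Im m)\<^sup>2 = 0"
    "4 * h\<^sup>2 * (s / (1 + s)) = 0"
    using zero_le_power2 [of "Im m"] by linarith+
  then have n: "1 - Re m = 2 * s / (1 + s)" and m0: "Im m = 0" and h0: "h = 0"
    using s0 by simp_all
  have "Re m = (1 - s) / (1 + s)" using n s0 by (simp add: field_simps)
  then show "cinner (A (A x)) x = complex_of_real ((1 - s) / (1 + s))"
    using m0 unfolding m_def z_def by (simp add: complex_eq_iff)
  have "4 * (Re g)\<^sup>2 + (2 * s / (1 + s))\<^sup>2 = 4 / (1 + s)"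
    using lower upper n m0 h0 Img by (simp add: cmod_power2 w power_mult_distrib)
  then have "(Re g)\<^sup>2 = 1 / (1 + s) - (s / (1 + s))\<^sup>2"
    by (simp add: power_mult_distrib power_divide)
  also have "\<dots> = (1 + s - s\<^sup>2) / (1 + s)\<^sup>2"
    using \<open>1 + s \<noteq> 0\<close> by (simp add: power_divide divide_simps) algebra
  finally have "Re g = sqrt ((1 + s - s\<^sup>2) / (1 + s)\<^sup>2)"
    using sector_Re_nonneg [OF \<alpha> sec [of x]] unfolding g_def z_def
    by (simp add: real_sqrt_unique)
  then have "Re g = sqrt (1 + s - s\<^sup>2) / (1 + s)"
    using s0 by (simp add: real_sqrt_divide)
  then show "cinner (A x) x = complex_of_real (sqrt (1 + s - s\<^sup>2) / (1 + s))"
    using Img h0 unfolding g_def z_def by (simp add: complex_eq_iff)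
qed

text \<open>The numerical radius is attained at \<open>x + \<i> z\<close> with phase \<open>\<kappa> / (2 w)\<close> and at \<open>x - \<i> z\<close> with the
  conjugate phase. For \<open>y\<close> orthogonal to \<open>x\<close> and \<open>z\<close> the two eigenvector equations are homogeneous linear
  equations for \<open>\<langle>A z, y\<rangle>\<close> and \<open>cnj \<langle>A y, x\<rangle>\<close>, and their determinant is a multiple of \<open>Re (\<kappa>\<^sup>2)\<close>,
  which is nonzero because \<open>s < 1\<close>.\<close>

lemma extremal_contraction_reduces:
  fixes A :: "'a::complex_inner \<Rightarrow> 'a"
  assumes \<alpha>: "0 < \<alpha>" "\<alpha> < pi / 2"
    and A: "bounded_clinear_on UNIV A"
    and sec: "\<And>y. cinner (A y) y \<in> sector \<alpha>"
    and rad: "\<And>y. cmod (cinner (A y) y) \<le> w * (norm y)\<^sup>2"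
    and s: "s = (sin \<alpha>)\<^sup>2" and w: "0 < w" "w\<^sup>2 = 1 / (1 + s)"
    and le: "\<And>y. norm (A y) \<le> norm y"
    and x: "norm x = 1" "norm (A x) = 1"
    and y: "cinner x y = 0" "cinner (A x) y = 0"
  shows "cinner (A (A x)) y = 0" and "cinner (A y) x = 0"
proof -
  note entries = extremal_contraction_entries [OF \<alpha> A sec rad s w(2) le x]
  have s0: "0 < s" using \<alpha> by (simp add: s sin_gt_zero2 less_imp_neq [symmetric] zero_less_power)
  have "cos \<alpha> \<noteq> 0" using \<alpha> cos_gt_zero [of \<alpha>] by simp
  then have s1: "s < 1" by (simp add: s sin_squared_eq)
  define z where "z = A x"
  have z: "norm z = 1" "A x = complex_of_real 1 *\<^sub>C z"
    using x by (simp_all add: z_def scaleC_one)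
  \<comment> \<open>the value \<open>P - \<i> (1 - m)\<close> of the form at \<open>x + \<i> z\<close>\<close>
  define \<kappa> where "\<kappa> = complex_of_real (2 * (sqrt (1 + s - s\<^sup>2) / (1 + s))) - \<i> * complex_of_real (2 * s / (1 + s))"
  have root: "0 < 1 + s - s\<^sup>2" using s0 s1 by (simp add: power2_eq_square mult_left_le)
      (smt (verit) mult_less_cancel_left2)
  have parts: "Re \<kappa> = 2 * (sqrt (1 + s - s\<^sup>2) / (1 + s))" "Im \<kappa> = - (2 * s / (1 + s))"
    by (simp_all add: \<kappa>_def)
  have squares: "(Re \<kappa>)\<^sup>2 = 4 * (1 + s - s\<^sup>2) / (1 + s)\<^sup>2" "(Im \<kappa>)\<^sup>2 = 4 * s\<^sup>2 / (1 + s)\<^sup>2"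
    unfolding parts using root by (simp_all add: power_mult_distrib power_divide)
  have s1': "1 + s \<noteq> 0" using s0 by simp
  have "(cmod \<kappa>)\<^sup>2 = (2 * w)\<^sup>2"
    unfolding cmod_power2 squares power_mult_distrib w using s1' by (simp add: divide_simps) algebra
  then have cmod_\<kappa>: "cmod \<kappa> = 2 * w" by (rule power2_eq_imp_eq) (use w in simp_all)
  have "Re (\<kappa>\<^sup>2) = (Re \<kappa>)\<^sup>2 - (Im \<kappa>)\<^sup>2" by (simp add: power2_eq_square)
  also have "\<dots> = 4 * (1 - s) * (1 + 2 * s) / (1 + s)\<^sup>2"
    unfolding squares using s1' by (simp add: divide_simps) algebra
  finally have "Re (\<kappa>\<^sup>2) = 4 * (1 - s) * (1 + 2 * s) / (1 + s)\<^sup>2" .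
  then have Re\<kappa>: "Re (\<kappa>\<^sup>2) \<noteq> 0" using s0 s1 by simp
  have zx: "cinner z x = complex_of_real (sqrt (1 + s - s\<^sup>2) / (1 + s))"
    using entries(2) by (simp add: z_def)
  have Imxz: "Im (cinner x z) = 0" by (subst cinner_commute) (simp add: zx)
  have touch: "cnj \<mu> * cinner (A v) y + \<mu> * cnj (cinner (A y) v) = 2 * complex_of_real (w) * cinner v y"
    if "\<mu> = k / complex_of_real (2 * w)" "cmod k = 2 * w" "(norm v)\<^sup>2 = 2" "cinner (A v) v = k" for \<mu> k v
    by (rule numerical_radius_attained [OF A rad])
      (use that w in \<open>simp_all add: norm_divide\<close>)
  have pencil: "cinner (A (x + l *\<^sub>C z)) (x + l *\<^sub>C z) = 2 * cinner z x + cnj l + l * complex_of_real ((1 - s) / (1 + s))"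
    if "cmod l = 1" for l
    unfolding clinear_pencil [OF A x(1) z] using that entries(1) [of z] entries(3) by (simp add: z_def)
  define X where "X = cinner (A z) y"
  define Y where "Y = cnj (cinner (A y) x)"
  have yz: "cinner (A y) z = 0"
    using entries(1) [of y] y by (simp add: z_def) (metis cinner_commute complex_cnj_zero)
  have key: "cnj k * (l * X) + k * Y = 0"
    if "cmod l = 1" "(norm (x + l *\<^sub>C z))\<^sup>2 = 2"
      "k = 2 * cinner z x + cnj l + l * complex_of_real ((1 - s) / (1 + s))" "cmod k = 2 * w" for l k
  proof -
    have "cinner (A (x + l *\<^sub>C z)) y = l * X" "cinner (A y) (x + l *\<^sub>C z) = cinner (A y) x"
      "cinner (x + l *\<^sub>C z) y = 0"
      using y yz by (simp_all add: clinear_add [OF A] clinear_scaleC [OF A] cinner_simps X_def z_def)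
    moreover have "cinner (A (x + l *\<^sub>C z)) (x + l *\<^sub>C z) = k"
      using pencil [OF that(1)] that(3) by simp
    ultimately have "cnj (k / complex_of_real (2 * w)) * (l * X) + k / complex_of_real (2 * w) * Y = 0"
      using touch [OF refl that(4,2)] unfolding Y_def by simp
    then have "(cnj k * (l * X) + k * Y) / complex_of_real (2 * w) = 0"
      by (simp add: add_divide_distrib)
    then show ?thesis using w by simp
  qed
  have minus: "x + (- \<i>) *\<^sub>C z = x - \<i> *\<^sub>C z"
    using scaleC_add_left [of "\<i>" "- \<i>" z] scaleC_add_left [of 0 0 z] by (simp add: algebra_simps)
  have \<kappa>_eq: "2 * cinner z x + cnj \<i> + \<i> * complex_of_real ((1 - s) / (1 + s)) = \<kappa>"
    unfolding zx \<kappa>_def using s0 by (simp add: complex_eq_iff field_simps)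
  have cnj_\<kappa>_eq: "2 * cinner z x + cnj (- \<i>) + (- \<i>) * complex_of_real ((1 - s) / (1 + s)) = cnj \<kappa>"
    unfolding zx \<kappa>_def using s0 by (simp add: complex_eq_iff field_simps)
  have 1: "cnj \<kappa> * (\<i> * X) + \<kappa> * Y = 0"
    by (rule key) (use \<kappa>_eq cmod_\<kappa> disc_pencil(2) [OF A rad x(1) z] Imxz in simp_all)
  have 2: "cnj (cnj \<kappa>) * (- \<i> * X) + cnj \<kappa> * Y = 0"
    by (rule key) (use cnj_\<kappa>_eq cmod_\<kappa> disc_pencil(3) [OF A rad x(1) z] Imxz minus in simp_all)
  have "\<i> * X * (\<kappa>\<^sup>2 + cnj (\<kappa>\<^sup>2)) = cnj \<kappa> * (cnj \<kappa> * (\<i> * X) + \<kappa> * Y)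
      - \<kappa> * (cnj (cnj \<kappa>) * (- \<i> * X) + cnj \<kappa> * Y)"
    by (simp add: power2_eq_square algebra_simps)
  then have "\<i> * X * (\<kappa>\<^sup>2 + cnj (\<kappa>\<^sup>2)) = 0" unfolding 1 2 by simp
  moreover have "\<kappa>\<^sup>2 + cnj (\<kappa>\<^sup>2) \<noteq> 0" using Re\<kappa> by (auto simp: complex_eq_iff simp del: complex_cnj_power)
  ultimately have X: "X = 0" by simp
  then have "Y = 0" using 1 cmod_\<kappa> w by auto
  with X show "cinner (A (A x)) y = 0" "cinner (A y) x = 0"
    by (simp_all add: X_def Y_def z_def)
qed

section \<open>Orthonormal pairs\<close>

text \<open>A Gram-Schmidt step: an independent set with more elements than \<open>F\<close> has an element outside the span
  of \<open>F\<close>; its component orthogonal to \<open>F\<close> is normalised.\<close>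

lemma exists_unit_orthogonal:
  fixes F :: "'a::complex_inner set"
  assumes E: "complex_vector.independent (E :: 'a set)" "finite E" "card F < card E"
    and F: "finite F" "\<And>u v. u \<in> F \<Longrightarrow> v \<in> F \<Longrightarrow> cinner u v = (if u = v then 1 else 0)"
  obtains e :: 'a where "norm e = 1" "\<And>f. f \<in> F \<Longrightarrow> cinner e f = 0"
proof -
  have "\<not> E \<subseteq> complex_vector.span F"
    using complex_vector.independent_span_bound [OF F(1) E(1)] E(3) by auto
  then obtain y where y: "y \<notin> complex_vector.span F" by blast
  define pr where "pr = (\<Sum>f\<in>F. cinner y f *\<^sub>C f)"
  have "pr \<in> complex_vector.span F"
    unfolding pr_def
    by (intro complex_vector.span_sum complex_vector.span_scale complex_vector.span_base)
  with y have r: "y - pr \<noteq> 0" by auto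
  have sum_left: "cinner (\<Sum>f\<in>G. a f *\<^sub>C f) v = (\<Sum>f\<in>G. a f * cinner f v)"
    if "finite G" for G :: "'a set" and a v
    using that by (induction G) (simp_all add: cinner_simps)
  have orth: "cinner (y - pr) f = 0" if "f \<in> F" for f
  proof -
    have "(\<Sum>u\<in>F. cinner y u * cinner u f) = (\<Sum>u\<in>F. if u = f then cinner y f else 0)"
      using that F(2) by (intro sum.cong) auto
    then show ?thesis
      using that F(1) by (simp add: pr_def cinner_diff_left sum_left)
  qed
  show ?thesis
  proof
    show "norm (complex_of_real (1 / norm (y - pr)) *\<^sub>C (y - pr)) = 1"
      using r by (simp add: norm_scaleC norm_divide)
    show "cinner (complex_of_real (1 / norm (y - pr)) *\<^sub>C (y - pr)) f = 0" if "f \<in> F" for f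
      using orth [OF that] by (simp add: cinner_scaleC_left)
  qed
qed

definition from_coords :: "'a::complex_inner \<Rightarrow> 'a \<Rightarrow> complex ^ 2 \<Rightarrow> 'a"
  where "from_coords p q z = z $ 1 *\<^sub>C p + z $ 2 *\<^sub>C q"

lemma cinner_cvec2: "cinner z z' = z $ 1 * cnj (z' $ 1) + z $ 2 * cnj (z' $ 2)"
  for z z' :: "complex ^ 2"
  by (simp add: cinner_vec_def sum_2 cinner_complex_def)

lemma norm_cvec2: "(norm z)\<^sup>2 = (cmod (z $ 1))\<^sup>2 + (cmod (z $ 2))\<^sup>2"
  for z :: "complex ^ 2"
  by (simp add: norm_vec_def L2_set_def sum_2)

lemma range_from_coords: "range (from_coords p q) = complex_vector.span {p, q}"
proof
  show "range (from_coords p q) \<subseteq> complex_vector.span {p, q}"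
    unfolding from_coords_def
    by (intro image_subsetI complex_vector.span_add complex_vector.span_scale complex_vector.span_base)
      simp_all
  show "complex_vector.span {p, q} \<subseteq> range (from_coords p q)"
  proof
    fix v assume "v \<in> complex_vector.span {p, q}"
    then obtain a b where "v - a *\<^sub>C p - b *\<^sub>C q = 0"
      unfolding complex_vector.span_insert complex_vector.span_empty by auto
    then have "v = from_coords p q (vector [a, b])"
      by (simp add: from_coords_def algebra_simps)
    then show "v \<in> range (from_coords p q)" by blast
  qed
qed

locale orthonormal_pair =
  fixes p q :: "'a::complex_inner"
  assumes norm_p: "norm p = 1" and norm_q: "norm q = 1" and orth: "cinner p q = 0"
begin

lemma cinner_pair [simp]: "cinner p p = 1" "cinner q q = 1" "cinner p q = 0" "cinner q p = 0"
  using norm_p norm_q orth cinner_commute [of q p] by (simp_all add: cinner_self)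

lemma unitary_onto_from_coords: "unitary_onto (from_coords p q) (complex_vector.span {p, q})"
  unfolding unitary_onto_def range_from_coords
  by (simp add: from_coords_def scaleC_add_left scaleC_add_right scaleC_scaleC cinner_simps cinner_cvec2
      scaleC_vec_def scaleC_complex_def algebra_simps)

lemma orth_complement_span:
  "r \<in> orth_complement (complex_vector.span {p, q}) \<longleftrightarrow> cinner r p = 0 \<and> cinner r q = 0"
proof
  assume "r \<in> orth_complement (complex_vector.span {p, q})"
  then show "cinner r p = 0 \<and> cinner r q = 0"
    by (simp add: orth_complement_def complex_vector.span_base)
qed (auto simp: orth_complement_def range_from_coords [symmetric] from_coords_def cinner_simps)

lemma orthogonal_decomposition:
  defines "V \<equiv> complex_vector.span {p, q}"
  obtains z r where "y = from_coords p q z + r" "r \<in> orth_complement V"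
    "z = vector [cinner y p, cinner y q]"
    "(norm y)\<^sup>2 = (norm z)\<^sup>2 + (norm r)\<^sup>2"
proof -
  define z :: "complex ^ 2" where "z = vector [cinner y p, cinner y q]"
  define r where "r = y - from_coords p q z"
  have y: "y = from_coords p q z + r" by (simp add: r_def)
  have r: "cinner r p = 0" "cinner r q = 0"
    by (simp_all add: r_def from_coords_def z_def cinner_simps)
  then have "cinner p r = 0" "cinner q r = 0" by (metis cinner_commute complex_cnj_zero)+
  then have "cinner y y = cinner z z + cinner r r"
    unfolding y using r by (simp add: from_coords_def cinner_simps cinner_cvec2)
  then have "(norm y)\<^sup>2 = (norm z)\<^sup>2 + (norm r)\<^sup>2"
    unfolding cinner_self of_real_add [symmetric] of_real_eq_iff .
  with y r show ?thesis using that z_def by (simp add: orth_complement_span V_def)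
qed

end

text \<open>Membership in the span by duality: a vector orthogonal to the complement of a
  two-dimensional subspace lies in that subspace.\<close>

lemma (in orthonormal_pair) eq_from_coordsI:
  assumes "\<And>r. cinner p r = 0 \<Longrightarrow> cinner q r = 0 \<Longrightarrow> cinner y r = 0"
  shows "y = from_coords p q (vector [cinner y p, cinner y q])"
proof -
  define z :: "complex ^ 2" where "z = vector [cinner y p, cinner y q]"
  define r where "r = y - from_coords p q z"
  have "cinner r p = 0" "cinner r q = 0"
    by (simp_all add: r_def from_coords_def z_def cinner_simps)
  then have *: "cinner p r = 0" "cinner q r = 0" by (metis cinner_commute complex_cnj_zero)+
  then have "cinner r r = 0"
    using assms [OF *] * cinner_diff_left [of y "from_coords p q z" r]
    unfolding r_def [symmetric] by (simp add: from_coords_def cinner_simps)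
  then show ?thesis by (simp add: cinner_eq_zero_iff r_def z_def)
qed

lemma exists_orthonormal_pair:
  fixes E :: "'h::complex_inner set"
  assumes "complex_vector.independent E" "card E = 3"
  obtains p q :: 'h where "orthonormal_pair p q"
proof -
  have E: "finite E" using assms(2) card.infinite [of E] by auto
  obtain p :: 'h where p: "norm p = 1"
    using exists_unit_orthogonal [OF assms(1) E, of "{}"] assms(2) by auto
  have "cinner p p = 1" using p by (simp add: cinner_self)
  then obtain q :: 'h where "norm q = 1" "cinner q p = 0"
    using exists_unit_orthogonal [OF assms(1) E, of "{p}"] assms(2) by auto
  then show ?thesis using that [of q p] p by (simp add: orthonormal_pair_def)
qed

section \<open>The extremal matrix\<close>

locale extremal_matrix =
  fixes \<alpha> \<theta> s c :: real
  assumes \<alpha>: "0 < \<alpha>" "\<alpha> < pi / 2"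
    and s: "s = (sin \<alpha>)\<^sup>2"
    and c: "c = s / sqrt (1 + 2 * s)"
    and \<theta>: "0 \<le> \<theta>" "\<theta> \<le> \<alpha>" "(cos \<theta>)\<^sup>2 = (1 + s - s\<^sup>2) / (1 + 2 * s)"
begin

lemma s_pos: "0 < s" and s_less: "s < 1" and sin_pos: "0 < sin \<alpha>" and cos_pos: "0 < cos \<alpha>"
  and cos_\<theta>_pos: "0 < cos \<theta>"
proof -
  show "0 < sin \<alpha>" using \<alpha> by (intro sin_gt_zero2) auto
  then show "0 < s" by (simp add: s)
  show "0 < cos \<alpha>" using \<alpha> by (intro cos_gt_zero) auto
  then show "s < 1" by (simp add: s sin_squared_eq)
  show "0 < cos \<theta>" using \<alpha> \<theta> by (intro cos_gt_zero_pi) auto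
qed

lemma c_pos: "0 < c" using s_pos by (simp add: c)

lemma c_squared: "c\<^sup>2 = s\<^sup>2 / (1 + 2 * s)" using s_pos by (simp add: c power_divide)

text \<open>The determinant of the real part of \<open>B\<close>. The equality says that the elliptic numerical range of \<open>B\<close>
  touches both sides of the sector.\<close>

lemma det_relation: "(cos \<theta>)\<^sup>2 - c\<^sup>2 = (cos \<alpha>)\<^sup>2"
proof -
  have "(cos \<alpha>)\<^sup>2 = 1 - s" by (simp add: s sin_squared_eq)
  moreover have "1 + 2 * s \<noteq> 0" using s_pos by simp
  ultimately show ?thesis
    unfolding \<theta>(3) c_squared by (simp add: divide_simps) (simp add: algebra_simps power2_eq_square)
qed

lemma c_less: "c < cos \<theta>"
proof -
  have "c\<^sup>2 < (cos \<theta>)\<^sup>2" using det_relation cos_pos by (smt (verit) zero_less_power)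
  then show ?thesis using cos_\<theta>_pos by (simp add: power_less_imp_less_base)
qed

text \<open>The quadratic form \<open>\<langle>B z, z\<rangle>\<close> in the coordinates \<open>z = (a, b)\<close>.\<close>

definition form :: "complex \<Rightarrow> complex \<Rightarrow> complex"
  where "form a b = complex_of_real ((cos \<theta> + c) * (cmod a)\<^sup>2 + (cos \<theta> - c) * (cmod b)\<^sup>2)
    + complex_of_real (sin \<alpha>) * (b * cnj a - a * cnj b)"

lemma Re_form: "Re (form a b) = (cos \<theta> + c) * (cmod a)\<^sup>2 + (cos \<theta> - c) * (cmod b)\<^sup>2"
  by (simp add: form_def)

lemma Im_form_le: "\<bar>Im (form a b)\<bar> \<le> 2 * sin \<alpha> * (cmod a * cmod b)"
proof -
  have "Im (form a b) = 2 * sin \<alpha> * Im (b * cnj a)"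
    by (simp add: form_def algebra_simps)
  moreover have "\<bar>Im (b * cnj a)\<bar> \<le> cmod a * cmod b"
    using abs_Im_le_cmod [of "b * cnj a"] by (simp add: norm_mult mult.commute)
  ultimately show ?thesis using sin_pos by (simp add: abs_mult)
qed

lemma form_sector: "form a b \<in> sector \<alpha>"
proof -
  have cc: "0 < cos \<theta> - c" "0 < cos \<theta> + c" using c_less c_pos cos_\<theta>_pos by simp_all
  have "cos \<alpha> = sqrt (cos \<theta> + c) * sqrt (cos \<theta> - c)"
    using det_relation cos_pos cc
    by (simp add: real_sqrt_unique power2_eq_square algebra_simps flip: real_sqrt_mult)
  then have "2 * cos \<alpha> * (cmod a * cmod b) = 2 * (sqrt (cos \<theta> + c) * cmod a) * (sqrt (cos \<theta> - c) * cmod b)"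
    by simp
  also have "\<dots> \<le> (sqrt (cos \<theta> + c) * cmod a)\<^sup>2 + (sqrt (cos \<theta> - c) * cmod b)\<^sup>2"
    by (rule sum_squares_bound)
  also have "\<dots> = Re (form a b)" using cc by (simp add: Re_form power_mult_distrib)
  finally have "2 * cos \<alpha> * (cmod a * cmod b) \<le> Re (form a b)" .
  then have "sin \<alpha> * (2 * cos \<alpha> * (cmod a * cmod b)) \<le> sin \<alpha> * Re (form a b)"
    using sin_pos by (intro mult_left_mono) auto
  moreover have "\<bar>Im (form a b)\<bar> * cos \<alpha> \<le> 2 * sin \<alpha> * (cmod a * cmod b) * cos \<alpha>"
    using Im_form_le cos_pos by (intro mult_right_mono) auto
  ultimately show ?thesis
    unfolding sector_iff [OF \<alpha>] by (simp add: algebra_simps)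
qed

text \<open>The elliptic numerical range of \<open>B\<close> touches the circle of radius \<open>w\<close> in two conjugate points, so the gap
  \<open>w\<^sup>2 - |form|\<^sup>2\<close> is bounded below by a square that vanishes at their common real part.\<close>

lemma form_disc: "cmod (form a b) \<le> sqrt ((1 + 2 * s) / (1 + s)) * ((cmod a)\<^sup>2 + (cmod b)\<^sup>2)"
proof -
  define u where "u = (cmod a)\<^sup>2 + (cmod b)\<^sup>2"
  define v where "v = (cmod a)\<^sup>2 - (cmod b)\<^sup>2"
  have s1: "1 + s \<noteq> 0" "1 + 2 * s \<noteq> 0" "s \<noteq> 0" using s_pos by simp_all
  have "(Im (form a b))\<^sup>2 \<le> (2 * sin \<alpha> * (cmod a * cmod b))\<^sup>2"
    using Im_form_le by (meson abs_ge_zero order_trans power2_le_iff_abs_le abs_le_square_iff power2_abs power_mono)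
  also have "\<dots> = s * (u\<^sup>2 - v\<^sup>2)"
    by (simp add: s u_def v_def power_mult_distrib) algebra
  finally have "(cmod (form a b))\<^sup>2 \<le> (cos \<theta> * u + c * v)\<^sup>2 + s * (u\<^sup>2 - v\<^sup>2)"
    unfolding cmod_power2 Re_form u_def v_def by (simp add: algebra_simps)
  also have "\<dots> = (1 + 2 * s) / (1 + s) * u\<^sup>2
      - (c * cos \<theta> * u - (s - c\<^sup>2) * v)\<^sup>2 / (s * (1 + s) / (1 + 2 * s))"
  proof -
    \<comment> \<open>completing the square in \<open>v\<close>; the coefficient of \<open>v\<^sup>2\<close> is \<open>- (s - c\<^sup>2)\<close>\<close>
    have 1: "s - c\<^sup>2 = s * (1 + s) / (1 + 2 * s)"
      unfolding c_squared using s1 by (simp add: divide_simps) algebra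
    have "(c * cos \<theta> * u - (s - c\<^sup>2) * v)\<^sup>2 / (s - c\<^sup>2)
        = c\<^sup>2 * (cos \<theta>)\<^sup>2 / (s - c\<^sup>2) * u\<^sup>2 - 2 * c * cos \<theta> * u * v + (s - c\<^sup>2) * v\<^sup>2"
      using s1 1 by (simp add: divide_simps) algebra
    moreover have "c\<^sup>2 * (cos \<theta>)\<^sup>2 / (s - c\<^sup>2) = (1 + 2 * s) / (1 + s) - (cos \<theta>)\<^sup>2 - s"
      unfolding 1 unfolding c_squared \<theta>(3) using s1 by (simp add: divide_simps) algebra
    moreover have gen: "(cos \<theta> * u + c * v)\<^sup>2 + s * (u\<^sup>2 - v\<^sup>2)
        = W * u\<^sup>2 - ((W - (cos \<theta>)\<^sup>2 - s) * u\<^sup>2 - 2 * c * cos \<theta> * u * v + (s - c\<^sup>2) * v\<^sup>2)" for W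
      by (simp add: algebra_simps power2_eq_square)
    ultimately show ?thesis
      unfolding 1 [symmetric] gen [of "(1 + 2 * s) / (1 + s)"] by (simp only:)
  qed
  also have "\<dots> \<le> (1 + 2 * s) / (1 + s) * u\<^sup>2" using s_pos by simp
  also have "\<dots> = (sqrt ((1 + 2 * s) / (1 + s)) * u)\<^sup>2" using s_pos by (simp add: power_mult_distrib)
  finally show ?thesis unfolding u_def
    by (rule power2_le_imp_le) (use s_pos in simp)
qed

lemma sqrt_1_2s: "0 < sqrt (1 + 2 * s)" "(sqrt (1 + 2 * s))\<^sup>2 = 1 + 2 * s"
  using s_pos by simp_all

definition B :: "complex ^ 2 ^ 2"
  where "B = vector [vector [complex_of_real (cos \<theta> + c), complex_of_real (sin \<alpha>)],
                     vector [complex_of_real (- sin \<alpha>), complex_of_real (cos \<theta> - c)]]"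

lemma B_mult: "(B *v z) $ 1 = complex_of_real (cos \<theta> + c) * z $ 1 + complex_of_real (sin \<alpha>) * z $ 2"
  "(B *v z) $ 2 = complex_of_real (- sin \<alpha>) * z $ 1 + complex_of_real (cos \<theta> - c) * z $ 2"
  by (simp_all add: B_def matrix_vector_mult_def sum_2)

lemma cinner_B: "cinner (B *v z) z = form (z $ 1) (z $ 2)"
  unfolding cinner_cvec2 B_mult form_def of_real_add [of "(cos \<theta> + c) * (cmod (z $ 1))\<^sup>2"]
    of_real_mult [of "cos \<theta> + c"] of_real_mult [of "cos \<theta> - c"] complex_norm_square
  by (simp add: algebra_simps)

lemma B_additive: "B *v (z + z') = B *v z + B *v z'"
  by (simp add: vec_eq_iff forall_2 B_mult algebra_simps)

lemma B_scaleC: "B *v (a *\<^sub>C z) = a *\<^sub>C (B *v z)"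
  by (simp add: vec_eq_iff forall_2 B_mult scaleC_vec_def scaleC_complex_def algebra_simps)

text \<open>The defect \<open>\<parallel>B\<parallel>\<^sup>2 - B\<^sup>* B\<close> as a quadratic form; it has rank one, which
  is the content of \<open>defect_coefficients\<close>.\<close>

lemma norm_B_defect:
  "(1 + 2 * s) * (norm z)\<^sup>2 - (norm (B *v z))\<^sup>2
    = (1 + s - (cos \<theta> + c)\<^sup>2) * (cmod (z $ 1))\<^sup>2 + (1 + s - (cos \<theta> - c)\<^sup>2) * (cmod (z $ 2))\<^sup>2
      - 4 * c * sin \<alpha> * Re (z $ 1 * cnj (z $ 2))"
  unfolding norm_cvec2 B_mult cmod_power2 s by (simp add: algebra_simps power2_eq_square)

lemma defect_coefficients:
  "0 \<le> 1 + s - (cos \<theta> + c)\<^sup>2" "0 < 1 + s - (cos \<theta> - c)\<^sup>2"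
  "sqrt (1 + s - (cos \<theta> + c)\<^sup>2) * sqrt (1 + s - (cos \<theta> - c)\<^sup>2) = 2 * c * sin \<alpha>"
proof -
  define d where "d = s - c\<^sup>2"
  have C: "(cos \<theta>)\<^sup>2 = c\<^sup>2 + 1 - s" using det_relation by (simp add: s sin_squared_eq)
  have cs: "c\<^sup>2 * (1 + 2 * s) = s\<^sup>2" unfolding c_squared using s_pos by simp
  have P: "1 + s - (cos \<theta> + c)\<^sup>2 = 2 * (d - c * cos \<theta>)" and Q: "1 + s - (cos \<theta> - c)\<^sup>2 = 2 * (d + c * cos \<theta>)"
    unfolding d_def power2_sum power2_diff C by (simp_all add: algebra_simps)
  have prod: "(d - c * cos \<theta>) * (d + c * cos \<theta>) = c\<^sup>2 * s"
    unfolding d_def using C cs by algebra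
  have "c\<^sup>2 * (1 + 2 * s) < s * (1 + 2 * s)"
    unfolding cs using s_pos by (simp add: power2_eq_square algebra_simps add_pos_pos)
  then have "0 < d" using s_pos by (simp add: d_def)
  moreover have cC: "0 < c * cos \<theta>" using c_pos cos_\<theta>_pos by simp
  ultimately have Q0: "0 < d + c * cos \<theta>" by simp
  then have P0: "0 \<le> d - c * cos \<theta>"
    using prod s_pos by (metis mult_nonneg_nonneg zero_le_power2 less_imp_le zero_le_mult_iff not_le)
  show "0 \<le> 1 + s - (cos \<theta> + c)\<^sup>2" "0 < 1 + s - (cos \<theta> - c)\<^sup>2" unfolding P Q using P0 Q0 by simp_all
  have "2 * (d - c * cos \<theta>) * (2 * (d + c * cos \<theta>)) = 4 * ((d - c * cos \<theta>) * (d + c * cos \<theta>))"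
    by algebra
  also have "\<dots> = (2 * c * sin \<alpha>)\<^sup>2"
    unfolding prod by (simp add: s power_mult_distrib)
  finally have "2 * (d - c * cos \<theta>) * (2 * (d + c * cos \<theta>)) = (2 * c * sin \<alpha>)\<^sup>2" .
  then show "sqrt (1 + s - (cos \<theta> + c)\<^sup>2) * sqrt (1 + s - (cos \<theta> - c)\<^sup>2) = 2 * c * sin \<alpha>"
    unfolding P Q using c_pos sin_pos by (simp flip: real_sqrt_mult)
qed

lemma norm_B_le: "norm (B *v z) \<le> sqrt (1 + 2 * s) * norm z"
proof -
  define u where "u = sqrt (1 + s - (cos \<theta> + c)\<^sup>2) * cmod (z $ 1)"
  define v where "v = sqrt (1 + s - (cos \<theta> - c)\<^sup>2) * cmod (z $ 2)"
  have "4 * c * sin \<alpha> * Re (z $ 1 * cnj (z $ 2)) \<le> 4 * c * sin \<alpha> * (cmod (z $ 1) * cmod (z $ 2))"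
    using complex_Re_le_cmod [of "z $ 1 * cnj (z $ 2)"] c_pos sin_pos
    by (intro mult_left_mono) (simp_all add: norm_mult)
  also have "\<dots> = 2 * (2 * c * sin \<alpha>) * (cmod (z $ 1) * cmod (z $ 2))" by simp
  also have "\<dots> = 2 * u * v"
    unfolding defect_coefficients(3) [symmetric] u_def v_def by (simp only: mult_ac)
  also have "\<dots> \<le> u\<^sup>2 + v\<^sup>2" by (rule sum_squares_bound)
  finally have "0 \<le> (1 + 2 * s) * (norm z)\<^sup>2 - (norm (B *v z))\<^sup>2"
    unfolding norm_B_defect u_def v_def power_mult_distrib using defect_coefficients(1,2) by simp
  then have "(norm (B *v z))\<^sup>2 \<le> (sqrt (1 + 2 * s) * norm z)\<^sup>2"
    unfolding power_mult_distrib sqrt_1_2s(2) by simp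
  then show ?thesis by (rule power2_le_imp_le) (use s_pos in simp)
qed

lemma norm_B_attained: obtains z where "z \<noteq> 0" "norm (B *v z) = sqrt (1 + 2 * s) * norm z"
proof
  \<comment> \<open>the kernel vector of the rank one defect form\<close>
  define u where "u = sqrt (1 + s - (cos \<theta> - c)\<^sup>2)"
  define v where "v = sqrt (1 + s - (cos \<theta> + c)\<^sup>2)"
  define z :: "complex ^ 2" where "z = vector [complex_of_real u, complex_of_real v]"
  have uv: "u\<^sup>2 = 1 + s - (cos \<theta> - c)\<^sup>2" "v\<^sup>2 = 1 + s - (cos \<theta> + c)\<^sup>2" "0 < u"
    using defect_coefficients(1,2) by (simp_all add: u_def v_def)
  show "z \<noteq> 0" using uv(3) by (auto simp: z_def vec_eq_iff forall_2)
  have "(1 + 2 * s) * (norm z)\<^sup>2 - (norm (B *v z))\<^sup>2 = v\<^sup>2 * u\<^sup>2 + u\<^sup>2 * v\<^sup>2 - 2 * (2 * c * sin \<alpha>) * (u * v)"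
    unfolding norm_B_defect by (simp add: z_def flip: uv(1,2))
  also have "2 * c * sin \<alpha> = v * u"
    unfolding u_def v_def by (rule defect_coefficients(3) [symmetric])
  finally have "(1 + 2 * s) * (norm z)\<^sup>2 - (norm (B *v z))\<^sup>2 = 0"
    by (simp add: power2_eq_square)
  then have "(norm (B *v z))\<^sup>2 = (sqrt (1 + 2 * s) * norm z)\<^sup>2"
    unfolding power_mult_distrib sqrt_1_2s(2) by simp
  then show "norm (B *v z) = sqrt (1 + 2 * s) * norm z"
    by (rule power2_eq_imp_eq) (use s_pos in simp_all)
qed

lemma matrix_norm_B: "matrix_norm B = sqrt (1 + 2 * s)"
proof (rule antisym)
  show "matrix_norm B \<le> sqrt (1 + 2 * s)"
    by (rule onorm_bound) (use s_pos norm_B_le in simp_all)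
  have "bounded_linear (\<lambda>z. B *v z)"
    by (rule bounded_linear_intro [where K = "sqrt (1 + 2 * s)"])
      (use norm_B_le in \<open>simp_all add: B_additive scaleR_scaleC B_scaleC mult.commute\<close>)
  note le_onorm [OF this]
  moreover obtain z where "z \<noteq> 0" "norm (B *v z) = sqrt (1 + 2 * s) * norm z"
    by (rule norm_B_attained)
  ultimately show "sqrt (1 + 2 * s) \<le> matrix_norm B"
    by (metis nonzero_mult_div_cancel_right norm_eq_zero)
qed

lemma form_vec_disc: "cmod (cinner (B *v z) z) \<le> sqrt ((1 + 2 * s) / (1 + s)) * (norm z)\<^sup>2"
  unfolding cinner_B norm_cvec2 by (rule form_disc)

end

section \<open>The value of tau\<close>

context extremal_matrix
begin

text \<open>The supremum is attained by \<open>B \<oplus> 0\<close> on the span of an orthonormal pair and its complement.\<close>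

theorem tau_eq:
  assumes "orthonormal_pair p (q :: 'h::chilbert_space)"
  shows "tau TYPE('h) \<alpha> = sqrt (1 + s)"
proof -
  interpret orthonormal_pair p q by fact
  let ?R = "{onorm T / numerical_radius T |T :: 'h \<Rightarrow> 'h.
    bounded_clinear_on UNIV T \<and> T \<noteq> (\<lambda>_. 0) \<and> numerical_range T \<subseteq> sector \<alpha>}"
  define S where "S = (\<lambda>y. from_coords p q (B *v vector [cinner y p, cinner y q]))"
  have S_vec: "cinner (S y) y = cinner (B *v z) z" "norm (S y) = norm (B *v z)" "norm z \<le> norm y"
    if "z = vector [cinner y p, cinner y q]" for y z
  proof -
    have "cinner p y = cnj (cinner y p)" "cinner q y = cnj (cinner y q)"
      by (rule cinner_commute)+
    then show "cinner (S y) y = cinner (B *v z) z"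
      by (simp add: S_def from_coords_def cinner_simps cinner_cvec2 that)
    have "cinner (S y) (S y) = cinner (B *v z) (B *v z)"
      using unitary_onto_from_coords by (simp add: S_def unitary_onto_def that)
    then show "norm (S y) = norm (B *v z)" by (simp add: norm_eq_sqrt_cinner)
    show "norm z \<le> norm y"
    proof (rule power2_le_imp_le)
      show "(norm z)\<^sup>2 \<le> (norm y)\<^sup>2"
        by (rule orthogonal_decomposition [of y]) (simp add: that)
    qed simp
  qed
  have S: "bounded_clinear_on UNIV S"
    unfolding bounded_clinear_on_def
  proof (intro conjI ballI allI exI)
    have U: "from_coords p q (z + z') = from_coords p q z + from_coords p q z'" "from_coords p q (a *\<^sub>C z) = a *\<^sub>C from_coords p q z"
      for z z' a using unitary_onto_from_coords by (simp_all add: unitary_onto_def)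
    fix y y' :: 'h and a
    have "vector [cinner (y + y') p, cinner (y + y') q]
        = (vector [cinner y p, cinner y q] + vector [cinner y' p, cinner y' q] :: complex ^ 2)"
      by (simp add: vec_eq_iff forall_2 cinner_simps)
    then show "S (y + y') = S y + S y'" unfolding S_def by (simp add: B_additive U)
    have "vector [cinner (a *\<^sub>C y) p, cinner (a *\<^sub>C y) q]
        = (a *\<^sub>C vector [cinner y p, cinner y q] :: complex ^ 2)"
      by (simp add: vec_eq_iff forall_2 cinner_simps scaleC_vec_def scaleC_complex_def)
    then show "S (a *\<^sub>C y) = a *\<^sub>C S y" unfolding S_def by (simp add: B_scaleC U)
    show "norm (S y) \<le> sqrt (1 + 2 * s) * norm y"
      unfolding S_vec(2) [OF refl]
      by (rule order_trans [OF norm_B_le mult_left_mono]) (use S_vec(3) s_pos in simp_all)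
  qed simp_all
  have S_sec: "numerical_range S \<subseteq> sector \<alpha>"
    unfolding numerical_range_sector_UNIV [OF \<alpha> S] S_vec(1) [OF refl] cinner_B
    using form_sector by blast
  obtain z where z: "z \<noteq> 0" "norm (B *v z) = sqrt (1 + 2 * s) * norm z" by (rule norm_B_attained)
  have zz: "z = vector [cinner (from_coords p q z) p, cinner (from_coords p q z) q]"
    by (simp add: from_coords_def cinner_simps vec_eq_iff forall_2)
  have "norm (from_coords p q z) = norm z"
    using unitary_onto_from_coords by (simp add: norm_eq_sqrt_cinner unitary_onto_def)
  then have "sqrt (1 + 2 * s) * norm z \<le> onorm S * norm z"
    using norm_clinear_le [OF S, of "from_coords p q z"] S_vec(2) [OF zz] z(2) by simp
  then have S_norm: "sqrt (1 + 2 * s) \<le> onorm S" using z(1) by simp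
  then have S_pos: "0 < onorm S" using sqrt_1_2s(1) by linarith
  have "numerical_radius S \<le> sqrt ((1 + 2 * s) / (1 + s))"
  proof (rule numerical_radius_on_le [OF _ UNIV_I norm_p])
    fix y
    define z :: "complex ^ 2" where "z = vector [cinner y p, cinner y q]"
    have "cmod (cinner (S y) y) \<le> sqrt ((1 + 2 * s) / (1 + s)) * (norm z)\<^sup>2"
      unfolding S_vec(1) [OF z_def] by (rule form_vec_disc)
    also have "\<dots> \<le> sqrt ((1 + 2 * s) / (1 + s)) * (norm y)\<^sup>2"
      using S_vec(3) [OF z_def] s_pos by (intro mult_left_mono power_mono) simp_all
    finally show "cmod (cinner (S y) y) \<le> sqrt ((1 + 2 * s) / (1 + s)) * (norm y)\<^sup>2" .
  qed
  then have "sqrt (1 + s) * numerical_radius S \<le> sqrt (1 + s) * sqrt ((1 + 2 * s) / (1 + s))"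
    using s_pos by (intro mult_left_mono) simp_all
  also have "\<dots> = sqrt (1 + 2 * s)" using s_pos by (simp flip: real_sqrt_mult)
  finally have "onorm S / numerical_radius S = sqrt (1 + s)"
    using sectorial_ratio_eq [OF \<alpha> s S S_sec norm_p S_pos] S_norm by simp
  moreover have "S \<noteq> (\<lambda>_. 0)"
  proof
    assume "S = (\<lambda>_. 0)"
    then have "onorm S = 0" by (simp add: onorm_zero)
    then show False using S_pos by simp
  qed
  ultimately have mem: "sqrt (1 + s) \<in> ?R" using S S_sec by (smt (verit) mem_Collect_eq)
  have upper: "r \<le> sqrt (1 + s)" if "r \<in> ?R" for r
  proof -
    from that obtain T :: "'h \<Rightarrow> 'h" where T: "r = onorm T / numerical_radius T"
      "bounded_clinear_on UNIV T" "numerical_range T \<subseteq> sector \<alpha>" by blast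
    show ?thesis
      using sectorial_ratio_le [OF \<alpha> s T(2,3) norm_p] numerical_radius_nonneg [OF T(2) norm_p] s_pos
      unfolding T(1) by (cases "numerical_radius T = 0") (simp_all add: pos_divide_le_eq)
  qed
  show ?thesis unfolding tau_def by (rule cSup_eq_maximum [OF mem upper])
qed

end

section \<open>Extremal operators are the block sums\<close>

context extremal_matrix
begin

lemma normalized_B_mult:
  "((1 / sqrt (1 + 2 * s)) *\<^sub>R B) *v z = (1 / sqrt (1 + 2 * s)) *\<^sub>R (B *v z)"
  by (simp add: vec_eq_iff forall_2 matrix_vector_mult_def sum_2 algebra_simps)

lemma normalized_B_entries:
  "(((1 / sqrt (1 + 2 * s)) *\<^sub>R B) *v z) $ 1 = complex_of_real ((cos \<theta> + c) / sqrt (1 + 2 * s)) * z $ 1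
    + complex_of_real (sin \<alpha> / sqrt (1 + 2 * s)) * z $ 2"
  "(((1 / sqrt (1 + 2 * s)) *\<^sub>R B) *v z) $ 2 = complex_of_real (- (sin \<alpha> / sqrt (1 + 2 * s))) * z $ 1
    + complex_of_real ((cos \<theta> - c) / sqrt (1 + 2 * s)) * z $ 2"
  unfolding normalized_B_mult vector_scaleR_component B_mult
  by (simp_all add: scaleR_conv_of_real algebra_simps add_divide_distrib diff_divide_distrib)

text \<open>Entries of a \<open>2 \<times> 2\<close> compression in the basis of the directions of \<open>x + z\<close> and \<open>x - z\<close>, computed
  from \<open>g = \<langle>x, z\<rangle>\<close> and \<open>m = \<langle>A z, x\<rangle>\<close>. With \<open>t = sqrt (1 + s - s\<^sup>2)\<close> and \<open>k = \<parallel>B\<parallel>\<close> one has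
  \<open>cos \<theta> = t / k\<close> and \<open>c = s / k\<close>, and all identities become rational in \<open>s\<close> and \<open>t\<close>.\<close>

lemma entry_relations:
  defines "g \<equiv> sqrt (1 + s - s\<^sup>2) / (1 + s)" and "m \<equiv> (1 - s) / (1 + s)" and "k \<equiv> sqrt (1 + 2 * s)"
  shows "0 < g" "g < 1"
    and "(2 * g + 1 + m) / (2 + 2 * g) = (cos \<theta> + c) / k"
    and "(2 * g - 1 - m) / (2 - 2 * g) = (cos \<theta> - c) / k"
    and "(1 - m) / (sqrt (2 + 2 * g) * sqrt (2 - 2 * g)) = sin \<alpha> / k"
proof -
  define t where "t = sqrt (1 + s - s\<^sup>2)"
  have root: "0 < 1 + s - s\<^sup>2" using s_pos s_less by (simp add: power2_eq_square mult_left_le)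
      (smt (verit) mult_less_cancel_left2)
  have t: "0 < t" "t\<^sup>2 = 1 + s - s\<^sup>2" using root by (simp_all add: t_def)
  have "t\<^sup>2 < (1 + s)\<^sup>2" unfolding t using s_pos by (simp add: power2_sum) (simp add: add_pos_pos)
  then have t_less: "t < 1 + s" by (rule power_less_imp_less_base) (use s_pos in simp)
  have g: "g = t / (1 + s)" by (simp add: g_def t_def)
  show g01: "0 < g" "g < 1" using t t_less s_pos by (simp_all add: g)
  have k: "0 < k" "k\<^sup>2 = 1 + 2 * s" using sqrt_1_2s by (simp_all add: k_def)
  have "(cos \<theta>)\<^sup>2 = (t / k)\<^sup>2" unfolding power_divide t k by (rule \<theta>(3))
  then have cos: "cos \<theta> = t / k" by (rule power2_eq_imp_eq) (use cos_\<theta>_pos t k in simp_all)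
  have ck: "c = s / k" by (simp add: c k_def)
  have nz: "1 + s \<noteq> 0" "1 + 2 * s \<noteq> 0" "1 + s + t \<noteq> 0" "1 + s - t \<noteq> 0" "k \<noteq> 0"
    using s_pos t t_less k by simp_all
  have g2: "2 + 2 * g = 2 * (1 + s + t) / (1 + s)" "2 - 2 * g = 2 * (1 + s - t) / (1 + s)"
    unfolding g using nz by (simp_all add: field_simps)
  have m1: "1 + m = 2 / (1 + s)" "1 - m = 2 * s / (1 + s)"
    unfolding m_def using nz by (simp_all add: field_simps)
  have "(2 * g + 1 + m) / (2 + 2 * g) = (t + 1) / (1 + s + t)"
    unfolding g2 add.assoc m1 unfolding g using nz by (simp add: divide_simps) algebra
  also have "\<dots> = (t + s) / (1 + 2 * s)"
    using nz t(2) by (simp add: frac_eq_eq) algebra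
  also have "\<dots> = (cos \<theta> + c) / k"
    unfolding cos ck using k by (simp add: power2_eq_square flip: add_divide_distrib)
  finally show "(2 * g + 1 + m) / (2 + 2 * g) = (cos \<theta> + c) / k" .
  have "(2 * g - 1 - m) / (2 - 2 * g) = (t - 1) / (1 + s - t)"
    unfolding g2 diff_diff_add m1 unfolding g using nz by (simp add: divide_simps) algebra
  also have "\<dots> = (t - s) / (1 + 2 * s)"
    using nz t(2) by (simp add: frac_eq_eq) algebra
  also have "\<dots> = (cos \<theta> - c) / k"
    unfolding cos ck using k by (simp add: power2_eq_square flip: diff_divide_distrib)
  finally show "(2 * g - 1 - m) / (2 - 2 * g) = (cos \<theta> - c) / k" .
  have "((1 - m) / (sqrt (2 + 2 * g) * sqrt (2 - 2 * g)))\<^sup>2 = (1 - m)\<^sup>2 / ((2 + 2 * g) * (2 - 2 * g))"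
    using g01 by (simp add: power_divide power_mult_distrib)
  also have "\<dots> = s\<^sup>2 / ((1 + s)\<^sup>2 - t\<^sup>2)"
    unfolding m1 g2 using nz by (simp add: power2_eq_square divide_simps) algebra
  also have "\<dots> = s / (1 + 2 * s)"
  proof -
    have "(1 + s)\<^sup>2 - t\<^sup>2 = s * (1 + 2 * s)" unfolding t by algebra
    then show ?thesis using s_pos by (simp add: power2_eq_square)
  qed
  also have "\<dots> = (sin \<alpha> / k)\<^sup>2" by (simp add: power_divide k s)
  finally show "(1 - m) / (sqrt (2 + 2 * g) * sqrt (2 - 2 * g)) = sin \<alpha> / k"
    by (rule power2_eq_imp_eq) (use g01 m1(2) s_pos sin_pos k in simp_all)
qed

text \<open>Since \<open>\<langle>x, z\<rangle>\<close> is real, \<open>x + z\<close> and \<open>x - z\<close> are orthogonal. In the case of \<open>B\<close> they are the coordinate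
  axes: \<open>diag(1, -1) B\<close> is real symmetric, so \<open>B\<close> maps its norming vector to a multiple of the mirror image.\<close>

lemma extremal_contraction_block:
  fixes A :: "'a::complex_inner \<Rightarrow> 'a"
  assumes A: "bounded_clinear_on UNIV A"
    and sec: "\<And>y. cinner (A y) y \<in> sector \<alpha>"
    and rad: "\<And>y. cmod (cinner (A y) y) \<le> w * (norm y)\<^sup>2"
    and w: "0 < w" "w\<^sup>2 = 1 / (1 + s)"
    and le: "\<And>y. norm (A y) \<le> norm y"
    and x: "norm x = 1" "norm (A x) = 1"
  obtains p q where "orthonormal_pair p q" "complex_vector.span {p, q} = complex_vector.span {x, A x}"
    "\<And>z. A (from_coords p q z) = from_coords p q (((1 / sqrt (1 + 2 * s)) *\<^sub>R B) *v z)"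
    "\<And>r. cinner r p = 0 \<Longrightarrow> cinner r q = 0 \<Longrightarrow> cinner (A r) p = 0 \<and> cinner (A r) q = 0"
proof -
  note entries = extremal_contraction_entries [OF \<alpha> A sec rad s w(2) le x]
  note reduces = extremal_contraction_reduces [OF \<alpha> A sec rad s w le x]
  define g where "g = sqrt (1 + s - s\<^sup>2) / (1 + s)"
  define m where "m = (1 - s) / (1 + s)"
  define k where "k = sqrt (1 + 2 * s)"
  note rel = entry_relations [folded g_def m_def k_def]
  define a where "a = sqrt (2 + 2 * g)"
  define b where "b = sqrt (2 - 2 * g)"
  have ab: "0 < a" "0 < b" "a\<^sup>2 = 2 + 2 * g" "b\<^sup>2 = 2 - 2 * g"
    using rel(1,2) by (simp_all add: a_def b_def)
  have ab': "complex_of_real a \<noteq> 0" "complex_of_real b \<noteq> 0" using ab by simp_all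
  define z where "z = A x"
  define p where "p = complex_of_real (1 / a) *\<^sub>C (x + z)"
  define q where "q = complex_of_real (1 / b) *\<^sub>C (x - z)"
  have zx: "cinner z x = complex_of_real g" using entries(2) by (simp add: z_def g_def)
  then have xz: "cinner x z = complex_of_real g" by (subst cinner_commute) simp
  have xx: "cinner x x = 1" "cinner z z = 1" using x by (simp_all add: cinner_self z_def)
  have pp: "cinner p p = 1"
  proof -
    have "cinner p p = complex_of_real ((2 + 2 * g) / a\<^sup>2)"
      by (simp add: p_def cinner_simps zx xz xx power2_eq_square add_divide_distrib
          diff_divide_distrib algebra_simps)
    then show ?thesis using ab rel(1,2) by simp
  qed
  have qq: "cinner q q = 1"
  proof -
    have "cinner q q = complex_of_real ((2 - 2 * g) / b\<^sup>2)"
      by (simp add: q_def cinner_simps zx xz xx power2_eq_square add_divide_distrib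
          diff_divide_distrib algebra_simps)
    then show ?thesis using ab rel(1,2) by simp
  qed
  have pq: "cinner p q = 0" by (simp add: p_def q_def cinner_simps zx xz xx)
  have pair: "orthonormal_pair p q"
    using pp qq pq by (simp add: orthonormal_pair_def norm_eq_sqrt_cinner)
  interpret orthonormal_pair p q by (rule pair)
  have apbq: "complex_of_real a *\<^sub>C p = x + z" "complex_of_real b *\<^sub>C q = x - z"
    using ab by (simp_all add: p_def q_def scaleC_scaleC scaleC_one)
  have two: "complex_of_real (1 / 2) *\<^sub>C (v + v) = v" for v :: 'a
    by (simp add: scaleC_add_right scaleC_one flip: scaleC_add_left)
  have x_eq: "x = complex_of_real (1 / 2) *\<^sub>C (complex_of_real a *\<^sub>C p + complex_of_real b *\<^sub>C q)"
    and z_eq: "z = complex_of_real (1 / 2) *\<^sub>C (complex_of_real a *\<^sub>C p - complex_of_real b *\<^sub>C q)"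
    unfolding apbq using two [of x] two [of z] by (simp_all add: algebra_simps)
  have span: "complex_vector.span {p, q} = complex_vector.span {x, A x}"
    unfolding complex_vector.span_eq
  proof (intro conjI)
    have "x \<in> complex_vector.span {x, z}" "z \<in> complex_vector.span {x, z}"
      by (simp_all add: complex_vector.span_base)
    then show "{p, q} \<subseteq> complex_vector.span {x, A x}"
      unfolding p_def q_def z_def
      by (simp add: complex_vector.span_scale complex_vector.span_add complex_vector.span_diff)
    have "p \<in> complex_vector.span {p, q}" "q \<in> complex_vector.span {p, q}"
      by (simp_all add: complex_vector.span_base)
    then have "complex_of_real (1 / 2) *\<^sub>C (complex_of_real a *\<^sub>C p + complex_of_real b *\<^sub>C q)
        \<in> complex_vector.span {p, q}"
      "complex_of_real (1 / 2) *\<^sub>C (complex_of_real a *\<^sub>C p - complex_of_real b *\<^sub>C q)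
        \<in> complex_vector.span {p, q}"
      by (simp_all add: complex_vector.span_scale complex_vector.span_add complex_vector.span_diff)
    then show "{x, A x} \<subseteq> complex_vector.span {p, q}" unfolding x_eq [symmetric] z_eq [symmetric] by (simp add: z_def)
  qed
  have orth_xz: "cinner x r = 0 \<and> cinner z r = 0 \<longleftrightarrow> cinner p r = 0 \<and> cinner q r = 0" for r
  proof
    assume "cinner x r = 0 \<and> cinner z r = 0"
    then show "cinner p r = 0 \<and> cinner q r = 0" by (simp add: p_def q_def cinner_simps)
  next
    assume "cinner p r = 0 \<and> cinner q r = 0"
    then show "cinner x r = 0 \<and> cinner z r = 0"
      by (subst x_eq, subst z_eq) (simp add: cinner_simps)
  qed
  have A_diff: "A (y - y') = A y - A y'" for y y'
    using clinear_add [OF A, of "y - y'" y'] by (simp add: algebra_simps)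
  have Ap: "A p = complex_of_real (1 / a) *\<^sub>C (z + A z)" and Aq: "A q = complex_of_real (1 / b) *\<^sub>C (z - A z)"
    unfolding p_def q_def clinear_scaleC [OF A] clinear_add [OF A] A_diff z_def by simp_all
  have Azx: "cinner (A z) x = complex_of_real m" using entries(3) by (simp add: z_def m_def)
  have Azz: "cinner (A z) z = complex_of_real g" using entries(1) [of z] zx by (simp add: z_def)
  have "cinner (A p) p = complex_of_real ((2 * g + 1 + m) / a\<^sup>2)"
    unfolding Ap unfolding p_def by (simp add: cinner_simps zx xx Azx Azz power2_eq_square add_divide_distrib
        diff_divide_distrib algebra_simps)
  then have App: "cinner (A p) p = complex_of_real ((cos \<theta> + c) / k)" unfolding ab(3) rel(3) .
  have "cinner (A q) q = complex_of_real ((2 * g - 1 - m) / b\<^sup>2)"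
    unfolding Aq unfolding q_def by (simp add: cinner_simps zx xx Azx Azz power2_eq_square add_divide_distrib
        diff_divide_distrib algebra_simps)
  then have Aqq: "cinner (A q) q = complex_of_real ((cos \<theta> - c) / k)" unfolding ab(4) rel(4) .
  have "cinner (A p) q = complex_of_real (- ((1 - m) / (a * b)))"
    unfolding Ap unfolding q_def by (simp add: cinner_simps zx xx Azx Azz algebra_simps diff_divide_distrib)
  then have Apq: "cinner (A p) q = complex_of_real (- (sin \<alpha> / k))" unfolding a_def b_def rel(5) .
  have "cinner (A q) p = complex_of_real ((1 - m) / (a * b))"
    unfolding Aq unfolding p_def by (simp add: cinner_simps zx xx Azx Azz algebra_simps diff_divide_distrib)
  then have Aqp: "cinner (A q) p = complex_of_real (sin \<alpha> / k)" unfolding a_def b_def rel(5) .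
  have inv: "cinner z r = 0 \<and> cinner (A z) r = 0" if "cinner p r = 0" "cinner q r = 0" for r
    using that orth_xz [of r] reduces(1) [of r] by (simp add: z_def)
  have "A p = from_coords p q (vector [cinner (A p) p, cinner (A p) q])"
    by (rule eq_from_coordsI) (simp add: Ap cinner_simps inv)
  then have Ap_eq: "A p = complex_of_real ((cos \<theta> + c) / k) *\<^sub>C p + complex_of_real (- (sin \<alpha> / k)) *\<^sub>C q"
    unfolding App Apq from_coords_def vector_2 .
  have "A q = from_coords p q (vector [cinner (A q) p, cinner (A q) q])"
    by (rule eq_from_coordsI) (simp add: Aq cinner_simps inv)
  then have Aq_eq: "A q = complex_of_real (sin \<alpha> / k) *\<^sub>C p + complex_of_real ((cos \<theta> - c) / k) *\<^sub>C q"
    unfolding Aqp Aqq from_coords_def vector_2 .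
  have block: "A (from_coords p q y) = from_coords p q (((1 / sqrt (1 + 2 * s)) *\<^sub>R B) *v y)" for y
  proof -
    have "A (from_coords p q y) = y $ 1 *\<^sub>C A p + y $ 2 *\<^sub>C A q"
      by (simp add: from_coords_def clinear_add [OF A] clinear_scaleC [OF A])
    also have "\<dots> = from_coords p q (((1 / sqrt (1 + 2 * s)) *\<^sub>R B) *v y)"
      unfolding Ap_eq Aq_eq from_coords_def normalized_B_entries k_def scaleC_add_right scaleC_add_left scaleC_scaleC
      by (simp only: mult.commute add_ac)
    finally show ?thesis .
  qed
  have "cinner (A r) p = 0 \<and> cinner (A r) q = 0" if "cinner r p = 0" "cinner r q = 0" for r
  proof -
    have "cinner p r = 0" "cinner q r = 0" using that by (metis cinner_commute complex_cnj_zero)+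
    then have r: "cinner x r = 0" "cinner z r = 0" using orth_xz [of r] by simp_all
    then have "cinner (A r) x = 0" using reduces(2) [of r] by (simp add: z_def)
    moreover have "cinner (A r) z = 0"
      using entries(1) [of r] r(1) by (simp add: z_def) (metis cinner_commute complex_cnj_zero)
    ultimately show ?thesis by (simp add: p_def q_def cinner_simps)
  qed
  then show ?thesis using that [OF pair span block] by blast
qed

end

context extremal_matrix
begin

lemma norm_attaining_extremal_is_block:
  fixes T :: "'h::chilbert_space \<Rightarrow> 'h"
  assumes dim: "complex_vector.independent (E :: 'h set)" "card E = 3"
    and T: "bounded_clinear_on UNIV T" "0 < onorm T"
    and x: "norm x = 1" "norm (T x) = onorm T"
    and sec: "numerical_range T \<subseteq> sector \<alpha>"
    and ratio: "onorm T / numerical_radius T = sqrt (1 + s)"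
  defines "V \<equiv> complex_vector.span {x, T x}" and "A \<equiv> \<lambda>y. (1 / onorm T) *\<^sub>R T y"
  shows "is_direct_sum A V A A"
    and "unitarily_similar_on V A ((1 / sqrt (1 + 2 * s)) *\<^sub>R B)"
    and "numerical_range_on (orth_complement V) A \<subseteq> sector \<alpha>"
    and "numerical_radius_on (orth_complement V) A \<le> 1 / sqrt (1 + s)"
proof -
  define N where "N = onorm T"
  have N: "0 < N" using T by (simp add: N_def)
  have A_eq: "A y = complex_of_real (1 / N) *\<^sub>C T y" for y
    by (simp add: A_def N_def scaleR_scaleC)
  have A_clinear: "bounded_clinear_on UNIV A"
    unfolding bounded_clinear_on_def
  proof (intro conjI ballI allI exI)
    show "norm (A y) \<le> 1 * norm y" for y
      using norm_clinear_le [OF T(1), of y] N by (simp add: A_def N_def field_simps)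
  qed (simp_all add: A_eq clinear_add [OF T(1)] clinear_scaleC [OF T(1)] scaleC_add_right
      scaleC_scaleC mult.commute)
  have A_le: "norm (A y) \<le> norm y" for y
    using norm_clinear_le [OF T(1), of y] N by (simp add: A_def N_def field_simps)
  have A_form: "cinner (A y) y = complex_of_real (1 / N) * cinner (T y) y" for y
    by (simp add: A_eq cinner_scaleC_left)
  have A_sec: "cinner (A y) y \<in> sector \<alpha>" for y
    unfolding A_form using sec N
    by (intro sector_scale \<alpha>) (simp_all add: numerical_range_sector_UNIV [OF \<alpha> T(1)])
  define w where "w = numerical_radius T / N"
  have "0 < numerical_radius T"
  proof (rule ccontr)
    assume "\<not> ?thesis"
    then have "numerical_radius T = 0" using numerical_radius_nonneg [OF T(1) x(1)] by simp
    then show False using ratio s_pos by simp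
  qed
  moreover from this have "N = sqrt (1 + s) * numerical_radius T"
    using ratio by (simp add: N_def divide_eq_eq)
  ultimately have w: "0 < w" "w = 1 / sqrt (1 + s)"
    using N s_pos by (simp_all add: w_def)
  have w2: "w\<^sup>2 = 1 / (1 + s)" using s_pos by (simp add: w power_divide)
  have A_rad: "cmod (cinner (A y) y) \<le> w * (norm y)\<^sup>2" for y
    unfolding A_form w_def norm_mult norm_of_real
    using cmod_cinner_le_numerical_radius [OF T(1), of y] N by (simp add: divide_right_mono)
  have Ax: "norm (A x) = 1" using x N by (simp add: A_def N_def)
  obtain p q where pair: "orthonormal_pair p q"
    and span: "complex_vector.span {p, q} = complex_vector.span {x, A x}"
    and block: "\<And>z. A (from_coords p q z) = from_coords p q (((1 / sqrt (1 + 2 * s)) *\<^sub>R B) *v z)"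
    and inv: "\<And>r. cinner r p = 0 \<Longrightarrow> cinner r q = 0 \<Longrightarrow> cinner (A r) p = 0 \<and> cinner (A r) q = 0"
    using extremal_contraction_block [OF A_clinear A_sec A_rad w(1) w2 A_le x(1) Ax] by blast
  interpret orthonormal_pair p q by (rule pair)
  have "V = complex_vector.span {x, A x}"
    unfolding V_def complex_vector.span_eq
  proof (intro conjI)
    have base: "x \<in> complex_vector.span {x, u}" "u \<in> complex_vector.span {x, u}" for u
      by (simp_all add: complex_vector.span_base)
    have "T x = complex_of_real N *\<^sub>C A x" using N by (simp add: A_eq scaleC_scaleC scaleC_one)
    then show "{x, T x} \<subseteq> complex_vector.span {x, A x}"
      using base [of "A x"] by (simp add: complex_vector.span_scale)
    show "{x, A x} \<subseteq> complex_vector.span {x, T x}"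
      using base [of "T x"] by (simp add: A_eq complex_vector.span_scale)
  qed
  then have V: "V = complex_vector.span {p, q}" using span by simp
  have A_on: "bounded_clinear_on M A" if "\<And>y. y \<in> M \<Longrightarrow> A y \<in> M" for M
    unfolding bounded_clinear_on_def
    using that A_le by (auto simp: clinear_add [OF A_clinear] clinear_scaleC [OF A_clinear]
        intro!: exI [of _ 1])
  have A_V: "A y \<in> V" if "y \<in> V" for y
    using that block unfolding V range_from_coords [symmetric] by auto
  have A_perp: "A y \<in> orth_complement V" if "y \<in> orth_complement V" for y
    using that inv unfolding V orth_complement_span by blast
  show "is_direct_sum A V A A"
    unfolding is_direct_sum_def using A_on [OF A_V] A_on [OF A_perp] clinear_add [OF A_clinear] by blast
  show "unitarily_similar_on V A ((1 / sqrt (1 + 2 * s)) *\<^sub>R B)"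
    unfolding unitarily_similar_on_def V using unitary_onto_from_coords block by blast
  show "numerical_range_on (orth_complement V) A \<subseteq> sector \<alpha>"
    using A_sec by (auto simp: numerical_range_on_def)
  have "card {p, q} < card E" "finite E"
    using dim(2) card_insert_le_m1 [of 2 "{q}" p] card.infinite [of E] by (auto simp: card_insert_if)
  moreover have "cinner u v = (if u = v then 1 else 0)" if "u \<in> {p, q}" "v \<in> {p, q}" for u v
    using that cinner_pair by auto
  ultimately obtain e where "norm e = 1" "\<And>f. f \<in> {p, q} \<Longrightarrow> cinner e f = 0"
    using exists_unit_orthogonal [OF dim(1), of "{p, q}"] by auto
  then have "e \<in> orth_complement V" "norm e = 1" unfolding V orth_complement_span by simp_all
  then show "numerical_radius_on (orth_complement V) A \<le> 1 / sqrt (1 + s)"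
    unfolding w(2) [symmetric] using A_rad by (intro numerical_radius_on_le)
qed

text \<open>For \<open>y = v + r\<close> with \<open>v\<close> in \<open>V\<close> and \<open>r\<close> orthogonal to \<open>V\<close> one has \<open>\<langle>A y, y\<rangle> = \<langle>T\<^sub>1 v, v\<rangle> + \<langle>T\<^sub>2 r, r\<rangle>\<close>, and
  the two blocks obey the same sector condition and the same bound \<open>1 / sqrt (1 + s)\<close>. This bounds
  the numerical radius from above; the reverse inequality is the sharp norm bound.\<close>

lemma block_is_extremal:
  fixes T :: "'h::chilbert_space \<Rightarrow> 'h"
  assumes T: "bounded_clinear_on UNIV T" "0 < onorm T" and x: "norm (x :: 'h) = 1"
    and sum: "is_direct_sum (\<lambda>y. (1 / onorm T) *\<^sub>R T y) V T\<^sub>1 T\<^sub>2"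
    and sim: "unitarily_similar_on V T\<^sub>1 ((1 / sqrt (1 + 2 * s)) *\<^sub>R B)"
    and sec: "numerical_range_on (orth_complement V) T\<^sub>2 \<subseteq> sector \<alpha>"
    and rad: "numerical_radius_on (orth_complement V) T\<^sub>2 \<le> 1 / sqrt (1 + s)"
  shows "numerical_range T \<subseteq> sector \<alpha>"
    and "onorm T / numerical_radius T = sqrt (1 + s)"
proof -
  define N where "N = onorm T"
  have N: "0 < N" using T by (simp add: N_def)
  obtain U :: "complex ^ 2 \<Rightarrow> 'h" where U: "unitary_onto U V"
    and T\<^sub>1: "\<And>z. T\<^sub>1 (U z) = U (((1 / sqrt (1 + 2 * s)) *\<^sub>R B) *v z)"
    using sim unfolding unitarily_similar_on_def by blast
  have U_cinner: "cinner (U z) (U z') = cinner z z'" for z z' using U by (simp add: unitary_onto_def)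
  define p where "p = U (axis 1 1)"
  define q where "q = U (axis 2 1)"
  have pair: "orthonormal_pair p q"
    by (simp add: orthonormal_pair_def norm_eq_sqrt_cinner p_def q_def U_cinner cinner_cvec2 axis_def)
  interpret orthonormal_pair p q by (rule pair)
  have U_from_coords: "U z = from_coords p q z" for z
  proof -
    have "z = z $ 1 *\<^sub>C axis 1 1 + z $ 2 *\<^sub>C axis 2 1"
      by (simp add: vec_eq_iff forall_2 scaleC_vec_def scaleC_complex_def axis_def)
    then show ?thesis using U unfolding unitary_onto_def from_coords_def p_def q_def by metis
  qed
  then have "U = from_coords p q" by blast
  then have V: "V = complex_vector.span {p, q}"
    using U range_from_coords [of p q] by (simp add: unitary_onto_def)
  let ?M = "orth_complement V"
  have M_scale: "a *\<^sub>C r \<in> ?M" if "r \<in> ?M" for a r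
    using that by (simp add: orth_complement_def cinner_scaleC_left)
  have T\<^sub>2: "\<And>r. r \<in> ?M \<Longrightarrow> T\<^sub>2 r \<in> ?M" "\<And>a r. r \<in> ?M \<Longrightarrow> T\<^sub>2 (a *\<^sub>C r) = a *\<^sub>C T\<^sub>2 r"
    using sum unfolding is_direct_sum_def bounded_clinear_on_def by blast+
  obtain K where K: "\<And>r. r \<in> ?M \<Longrightarrow> norm (T\<^sub>2 r) \<le> K * norm r"
    using sum unfolding is_direct_sum_def bounded_clinear_on_def by blast
  have form: "\<exists>z r. cinner (T y) y = complex_of_real N *
      (complex_of_real (1 / sqrt (1 + 2 * s)) * cinner (B *v z) z + cinner (T\<^sub>2 r) r)
      \<and> r \<in> ?M \<and> (norm y)\<^sup>2 = (norm z)\<^sup>2 + (norm r)\<^sup>2" for y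
  proof -
    obtain z r where y: "y = from_coords p q z + r" "r \<in> ?M" "(norm y)\<^sup>2 = (norm z)\<^sup>2 + (norm r)\<^sup>2"
      using orthogonal_decomposition [of y] unfolding V by metis
    have z: "from_coords p q z' \<in> V" for z' unfolding V range_from_coords [symmetric] by blast
    have zero: "cinner (from_coords p q z') r' = 0" "cinner r' (from_coords p q z') = 0" if "r' \<in> ?M" for z' r'
      using that z [of z'] by (auto simp: orth_complement_def) (metis cinner_commute complex_cnj_zero)
    have "(1 / N) *\<^sub>R T y = T\<^sub>1 (from_coords p q z) + T\<^sub>2 r"
      using sum z y(2) unfolding is_direct_sum_def N_def y(1) by blast
    then have "N *\<^sub>R ((1 / N) *\<^sub>R T y) = N *\<^sub>R (T\<^sub>1 (from_coords p q z) + T\<^sub>2 r)" by simp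
    then have "T y = complex_of_real N *\<^sub>C (U (((1 / sqrt (1 + 2 * s)) *\<^sub>R B) *v z) + T\<^sub>2 r)"
      using N T\<^sub>1 [of z] by (simp add: U_from_coords scaleR_scaleC [symmetric])
    moreover have "((1 / sqrt (1 + 2 * s)) *\<^sub>R B) *v z = complex_of_real (1 / sqrt (1 + 2 * s)) *\<^sub>C (B *v z)"
      by (rule trans [OF normalized_B_mult scaleR_scaleC])
    moreover have "cinner (from_coords p q (a *\<^sub>C (B *v z))) (from_coords p q z) = a * cinner (B *v z) z" for a
      using U_cinner [of "a *\<^sub>C (B *v z)" z] by (simp add: U_from_coords cinner_scaleC_left)
    ultimately have "cinner (T y) y = complex_of_real N *
      (complex_of_real (1 / sqrt (1 + 2 * s)) * cinner (B *v z) z + cinner (T\<^sub>2 r) r)"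
      using zero y(2) T\<^sub>2(1) [OF y(2)]
      by (simp add: y(1) cinner_scaleC_left cinner_add_left cinner_add_right U_from_coords distrib_left)
    with y show ?thesis by blast
  qed
  have "cinner (T y) y \<in> sector \<alpha>" for y
  proof -
    obtain z r where y: "cinner (T y) y = complex_of_real N *
      (complex_of_real (1 / sqrt (1 + 2 * s)) * cinner (B *v z) z + cinner (T\<^sub>2 r) r)" "r \<in> ?M"
      using form by blast
    have "cinner (T\<^sub>2 r) r \<in> sector \<alpha>"
      by (rule numerical_range_on_subset_sectorD [OF \<alpha> sec T\<^sub>2(2) M_scale y(2)])
    then show ?thesis
      unfolding y(1) cinner_B using N sqrt_1_2s(1) form_sector
      by (intro sector_scale sector_add \<alpha>) simp_all
  qed
  then show T_sec: "numerical_range T \<subseteq> sector \<alpha>"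
    by (simp add: numerical_range_sector_UNIV [OF \<alpha> T(1)])
  have "cmod (cinner (T y) y) \<le> N / sqrt (1 + s) * (norm y)\<^sup>2" for y
  proof -
    obtain z r where y: "cinner (T y) y = complex_of_real N *
      (complex_of_real (1 / sqrt (1 + 2 * s)) * cinner (B *v z) z + cinner (T\<^sub>2 r) r)" "r \<in> ?M"
      "(norm y)\<^sup>2 = (norm z)\<^sup>2 + (norm r)\<^sup>2"
      using form by blast
    have "cmod (complex_of_real (1 / sqrt (1 + 2 * s)) * cinner (B *v z) z)
        \<le> 1 / sqrt (1 + 2 * s) * (sqrt ((1 + 2 * s) / (1 + s)) * (norm z)\<^sup>2)"
      unfolding norm_mult norm_of_real using sqrt_1_2s(1) form_vec_disc [of z]
      by (simp add: divide_right_mono)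
    also have "\<dots> = 1 / sqrt (1 + s) * (norm z)\<^sup>2"
      using sqrt_1_2s(1) by (simp add: real_sqrt_divide)
    finally have "cmod (complex_of_real (1 / sqrt (1 + 2 * s)) * cinner (B *v z) z) \<le> 1 / sqrt (1 + s) * (norm z)\<^sup>2" .
    moreover have "cmod (cinner (T\<^sub>2 r) r) \<le> 1 / sqrt (1 + s) * (norm r)\<^sup>2"
      using numerical_radius_onD [OF K T\<^sub>2(2) M_scale y(2)] mult_right_mono [OF rad, of "(norm r)\<^sup>2"]
      by simp
    ultimately have "cmod (complex_of_real (1 / sqrt (1 + 2 * s)) * cinner (B *v z) z + cinner (T\<^sub>2 r) r)
        \<le> 1 / sqrt (1 + s) * (norm y)\<^sup>2"
      unfolding y(3) distrib_left by (meson add_mono norm_triangle_le)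
    then have "N * cmod (complex_of_real (1 / sqrt (1 + 2 * s)) * cinner (B *v z) z + cinner (T\<^sub>2 r) r)
        \<le> N * (1 / sqrt (1 + s) * (norm y)\<^sup>2)"
      using N by (intro mult_left_mono) simp_all
    then show ?thesis unfolding y(1) norm_mult [of "complex_of_real N"] using N by simp
  qed
  then have "numerical_radius T \<le> N / sqrt (1 + s)"
    by (rule numerical_radius_on_le [OF _ UNIV_I x])
  then have "sqrt (1 + s) * numerical_radius T \<le> onorm T"
    using s_pos by (simp add: N_def pos_le_divide_eq mult.commute)
  then show "onorm T / numerical_radius T = sqrt (1 + s)"
    by (rule sectorial_ratio_eq [OF \<alpha> s T(1) T_sec x T(2)])
qed

end

theorem theorem3p4:
  fixes \<alpha> \<theta> s c :: real
    and T :: "'h::chilbert_space \<Rightarrow> 'h"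
    and x :: 'h
    and V :: "'h set"
    and B :: "complex ^ 2 ^ 2"
  assumes "0 < \<alpha>" and "\<alpha> < pi / 2"
    and dim: "\<exists>E :: 'h set. card E = 3 \<and> complex_vector.independent E"
    and T: "bounded_clinear_on UNIV T" "T \<noteq> (\<lambda>_. 0)"
    and x: "norm x = 1" "norm (T x) = onorm T"
    and V: "V = complex_vector.span {x, T x}"
    and s: "s = (sin \<alpha>)\<^sup>2"
    and c: "c = s / sqrt (1 + 2 * s)"
    and \<theta>: "0 \<le> \<theta>" "\<theta> \<le> \<alpha>"
      "(sin \<theta>)\<^sup>2 = (s + s\<^sup>2) / (1 + 2 * s)"
      "(cos \<theta>)\<^sup>2 = (1 + s - s\<^sup>2) / (1 + 2 * s)"
    and B: "B = vector [vector [complex_of_real (cos \<theta> + c), complex_of_real (sin \<alpha>)],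
                        vector [complex_of_real (- sin \<alpha>), complex_of_real (cos \<theta> - c)]]"
  shows "numerical_range T \<subseteq> sector \<alpha> \<and> onorm T / numerical_radius T = tau TYPE('h) \<alpha> \<longleftrightarrow>
    (\<exists>T\<^sub>1 T\<^sub>2. is_direct_sum (\<lambda>y. (1 / onorm T) *\<^sub>R T y) V T\<^sub>1 T\<^sub>2 \<and>
       unitarily_similar_on V T\<^sub>1 ((1 / matrix_norm B) *\<^sub>R B) \<and>
       numerical_range_on (orth_complement V) T\<^sub>2 \<subseteq> sector \<alpha> \<and>
       numerical_radius_on (orth_complement V) T\<^sub>2 \<le> 1 / tau TYPE('h) \<alpha>)"
proof -
  interpret extremal_matrix \<alpha> \<theta> s c
    by unfold_locales (use assms in simp_all)
  have B: "B = extremal_matrix.B \<alpha> \<theta> c" unfolding B B_def ..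
  obtain E :: "'h set" where E: "complex_vector.independent E" "card E = 3" using dim by blast
  obtain p q :: 'h where "orthonormal_pair p q" by (rule exists_orthonormal_pair [OF E])
  then have tau: "tau TYPE('h) \<alpha> = sqrt (1 + s)" by (rule tau_eq)
  have "onorm T \<noteq> 0" using T onorm_eq_0 [OF bounded_clinear_imp_bounded_linear [OF T(1)]] by auto
  then have pos: "0 < onorm T"
    using onorm_pos_le [OF bounded_clinear_imp_bounded_linear [OF T(1)]] by simp
  show ?thesis
    unfolding tau B matrix_norm_B V
    using norm_attaining_extremal_is_block [OF E T(1) pos x] block_is_extremal [OF T(1) pos x(1)]
    by blast
qed

end
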